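(* Let $G$ be a finite nilpotent group and let $H$ be an arbitrary finite group. Then $P_e(G)\cong P_e(H)$ (as graphs) if and only if $H$ is nilpotent and, for every prime $p$, $P_e(G_p)\cong P_e(H_p)$, where $G_p$ and $H_p$ denote the Sylow $p$-subgroups of $G$ and $H$, respectively.
   Context: All groups are finite. For a group $X$, the enhanced power graph $P_e(X)$ is the simple graph with vertex set $X$ in which two distinct vertices $x,y$ are adjacent if and only if the subgroup $\langle x,y\rangle$ is cyclic. *)

theory Defs
  imports "HOL-Algebra.Algebra" "HOL-Computational_Algebra.Primes"
begin

definition epg_adj :: "('a, 'b) monoid_scheme \<Rightarrow> 'a \<Rightarrow> 'a \<Rightarrow> bool" where
  "epg_adj G x y \<longleftrightarrow> x \<noteq> y \<and> cyclic_group (subgroup_generated G {x, y})"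

definition epg_iso :: "('a, 'b) monoid_scheme \<Rightarrow> ('c, 'd) monoid_scheme \<Rightarrow> bool" where
  "epg_iso G H \<longleftrightarrow> (\<exists>f. bij_betw f (carrier G) (carrier H) \<and>
     (\<forall>x\<in>carrier G. \<forall>y\<in>carrier G. epg_adj G x y \<longleftrightarrow> epg_adj H (f x) (f y)))"

fun lower_central :: "('a, 'b) monoid_scheme \<Rightarrow> nat \<Rightarrow> 'a set" where
  "lower_central G 0 = carrier G"
| "lower_central G (Suc n) = generate G
     {x \<otimes>\<^bsub>G\<^esub> y \<otimes>\<^bsub>G\<^esub> inv\<^bsub>G\<^esub> x \<otimes>\<^bsub>G\<^esub> inv\<^bsub>G\<^esub> y | x y. x \<in> lower_central G n \<and> y \<in> carrier G}"

definition nilpotent :: "('a, 'b) monoid_scheme \<Rightarrow> bool" where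
  "nilpotent G \<longleftrightarrow> (\<exists>n. lower_central G n = {\<one>\<^bsub>G\<^esub>})"

definition sylow_subgroup :: "('a, 'b) monoid_scheme \<Rightarrow> nat \<Rightarrow> 'a set \<Rightarrow> bool" where
  "sylow_subgroup G p P \<longleftrightarrow> subgroup P G \<and> card P = p ^ Factorial_Ring.multiplicity p (order G)"

end

theory Submission
  imports Defs "HOL-Number_Theory.Cong"
begin

text \<open>
  For finite groups, nilpotency is equivalent to elements of coprime order commuting, and then the
  Sylow \<open>p\<close>-subgroup is the set of elements of \<open>p\<close>-power order.

  Write \<open>N(x)\<close> for the closed neighbourhood of \<open>x\<close> in the enhanced power graph. The set
  \<open>{z. N(x) \<subseteq> N(z)}\<close> is the intersection of the maximal cyclic subgroups containing \<open>x\<close>, so it is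
  itself cyclic and its cardinality determines how many elements of each order it has. By
  inclusion-exclusion over the fibres of \<open>N\<close>, a graph isomorphism preserves the number of elements
  of each order in every fibre; permuting within the fibres turns it into an isomorphism that
  preserves orders. Elements of coprime order commute iff they generate a cyclic group, so
  nilpotency transfers, and the isomorphism restricts to the Sylow subgroups.

  Conversely, in a nilpotent group \<open>\<langle>x, y\<rangle>\<close> is cyclic iff the \<open>p\<close>-parts of \<open>x\<close> and \<open>y\<close> generate a
  cyclic group for every \<open>p\<close>, so isomorphisms of the Sylow graphs combine to one of the whole graph.
\<close>

section \<open>Nilpotency and commuting elements of coprime order\<close>

abbreviation (in group) commutator :: "'a \<Rightarrow> 'a \<Rightarrow> 'a" where
  "commutator x y \<equiv> x \<otimes> y \<otimes> inv x \<otimes> inv y"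

text \<open>Stands in for nilpotency of finite groups: it speaks only of element orders and
  commutation, which an order-preserving graph isomorphism can transport.\<close>

definition coprime_orders_commute :: "('a, 'b) monoid_scheme \<Rightarrow> bool" where
  "coprime_orders_commute G \<longleftrightarrow>
     (\<forall>x\<in>carrier G. \<forall>y\<in>carrier G.
        coprime (group.ord G x) (group.ord G y) \<longrightarrow> x \<otimes>\<^bsub>G\<^esub> y = y \<otimes>\<^bsub>G\<^esub> x)"

section \<open>Commutators and the lower central series\<close>

lemma (in group) inv_cancel_left:
  assumes "x \<in> carrier G" "y \<in> carrier G"
  shows "inv x \<otimes> (x \<otimes> y) = y" "x \<otimes> (inv x \<otimes> y) = y"
  using assms by (simp_all flip: m_assoc)

lemma (in group) conjugate_commutator:
  assumes "g \<in> carrier G" "x \<in> carrier G" "y \<in> carrier G"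
  shows "g \<otimes> commutator x y \<otimes> inv g = commutator (g \<otimes> x \<otimes> inv g) (g \<otimes> y \<otimes> inv g)"
  using assms by (simp add: m_assoc inv_mult_group inv_cancel_left)

text \<open>The quotient of \<open>x \<otimes> y\<close> by \<open>y \<otimes> x\<close> is the
  commutator, so commuting modulo \<open>H\<close> can be tested on representatives in
  \<open>G\<close>.\<close>

lemma (in normal) rcos_mult_commute_iff:
  assumes "x \<in> carrier G" "y \<in> carrier G"
  shows "H #> (x \<otimes> y) = H #> (y \<otimes> x) \<longleftrightarrow> commutator x y \<in> H"
proof -
  have "H #> (x \<otimes> y) = H #> (y \<otimes> x) \<longleftrightarrow> x \<otimes> y \<in> H #> (y \<otimes> x)"
    by (metis assms m_closed rcos_self repr_independence subgroup_axioms)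
  also have "\<dots> \<longleftrightarrow> x \<otimes> y \<otimes> inv (y \<otimes> x) \<in> H"
    using assms by (intro rcos_module is_group) auto
  also have "x \<otimes> y \<otimes> inv (y \<otimes> x) = commutator x y"
    using assms by (simp add: inv_mult_group m_assoc)
  finally show ?thesis .
qed

text \<open>Conjugation permutes the generators: it acts on both entries of a commutator, and
  normality of the previous term keeps the first entry in place.\<close>

lemma (in group) lower_central_normal: "lower_central G n \<lhd> G"
proof (induction n)
  case 0
  show ?case by (simp add: normal_self)
next
  case (Suc n)
  note sub = subgroup.mem_carrier[OF normal_imp_subgroup[OF Suc]]
  show ?case unfolding lower_central.simps
  proof (rule normal_generateI)
    show "{commutator x y |x y. x \<in> lower_central G n \<and> y \<in> carrier G} \<subseteq> carrier G"
      using sub by auto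
    fix h g assume h: "h \<in> {commutator x y |x y. x \<in> lower_central G n \<and> y \<in> carrier G}"
      and g: "g \<in> carrier G"
    then obtain x y where xy: "h = commutator x y" "x \<in> lower_central G n" "y \<in> carrier G"
      by blast
    have "g \<otimes> h \<otimes> inv g = commutator (g \<otimes> x \<otimes> inv g) (g \<otimes> y \<otimes> inv g)"
      using xy g sub by (simp add: conjugate_commutator)
    moreover have "g \<otimes> x \<otimes> inv g \<in> lower_central G n"
      using normal.inv_op_closed2[OF Suc g xy(2)] .
    ultimately show "g \<otimes> h \<otimes> inv g \<in> {commutator x y |x y. x \<in> lower_central G n \<and> y \<in> carrier G}"
      using g xy by blast
  qed
qed

lemma (in group) commutator_in_lower_central_Suc:
  assumes "x \<in> lower_central G n" "y \<in> carrier G"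
  shows "commutator x y \<in> lower_central G (Suc n)"
  using assms by (auto intro!: generate.incl)

text \<open>Moving \<open>y\<close> past \<open>x [^] k\<close> costs a factor
  \<open>c [^] k\<close>, and likewise with the roles exchanged. Taking \<open>k = m\<close> and
  \<open>k = n\<close> kills both \<open>c [^] m\<close> and \<open>c [^] n\<close>, so
  \<open>ord c\<close> divides two coprime numbers.\<close>

lemma (in group) central_commutator_eq_one:
  assumes x: "x \<in> carrier G" and y: "y \<in> carrier G" and c: "c \<in> carrier G"
    and comm: "x \<otimes> y = c \<otimes> (y \<otimes> x)"
    and central: "c \<otimes> x = x \<otimes> c" "c \<otimes> y = y \<otimes> c"
    and m: "x [^] (m::nat) = \<one>" and n: "y [^] (n::nat) = \<one>" and "coprime m n"
  shows "c = \<one>"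
proof -
  have 1: "x [^] k \<otimes> y = c [^] k \<otimes> (y \<otimes> x [^] k)" for k :: nat
  proof (induction k)
    case (Suc k)
    have "x [^] Suc k \<otimes> y = x [^] k \<otimes> (c \<otimes> (y \<otimes> x))"
      using x y by (simp add: m_assoc comm)
    also have "\<dots> = c \<otimes> ((x [^] k \<otimes> y) \<otimes> x)"
      using x y c group_commutes_pow[OF central(1)[symmetric] x c, of k] by (simp flip: m_assoc)
    also have "\<dots> = c [^] Suc k \<otimes> (y \<otimes> x [^] Suc k)"
      using x y c group_commutes_pow[of c c k] by (simp add: Suc flip: m_assoc)
    finally show ?case .
  qed (use y in simp)
  have 2: "x \<otimes> y [^] k = c [^] k \<otimes> (y [^] k \<otimes> x)" for k :: nat
  proof (induction k)
    case (Suc k)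
    have "x \<otimes> y [^] Suc k = (x \<otimes> y [^] k) \<otimes> y"
      using x y by (simp add: m_assoc)
    also have "\<dots> = c [^] k \<otimes> (y [^] k \<otimes> (c \<otimes> (y \<otimes> x)))"
      using x y c by (simp add: Suc m_assoc comm)
    also have "\<dots> = c [^] k \<otimes> c \<otimes> (y [^] k \<otimes> y \<otimes> x)"
using x y c group_commutes_pow[OF central(2)[symmetric] y c, of k] by (simp flip: m_assoc)
    finally show ?case by simp
  qed (use x in simp)
  have "y = c [^] m \<otimes> y" using 1[of m] m y c by simp
  then have "c [^] m = \<one>" using y c r_cancel_one' by simp
  moreover have "x = c [^] n \<otimes> x" using 2[of n] n x c by simp
  then have "c [^] n = \<one>" using x c r_cancel_one' by simp
  ultimately have "ord c dvd 1"
    using \<open>coprime m n\<close> c coprime_common_divisor[of m n "ord c"] by (simp add: pow_eq_id)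
  then show ?thesis using c by (metis nat_dvd_1_iff_1 ord_eq_1)
qed

text \<open>In the quotient by \<open>H\<close> the commutator becomes central, so
  \<open>central_commutator_eq_one\<close> makes it trivial there.\<close>

lemma (in normal) commutator_mem_of_central:
  assumes x: "x \<in> carrier G" and y: "y \<in> carrier G" and cop: "coprime (ord x) (ord y)"
    and central: "\<And>z. z \<in> carrier G \<Longrightarrow> commutator (commutator x y) z \<in> H"
  shows "commutator x y \<in> H"
proof -
  define c where "c = commutator x y"
  have c: "c \<in> carrier G" unfolding c_def using x y by simp
  define \<phi> where "\<phi> a = H #> a" for a
  interpret Q: group "G Mod H" by (rule factorgroup_is_group)
  have hom: "\<phi> (a \<otimes> b) = \<phi> a \<otimes>\<^bsub>G Mod H\<^esub> \<phi> b" if "a \<in> carrier G" "b \<in> carrier G" for a b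
    using hom_mult[OF r_coset_hom_Mod that] by (simp only: \<phi>_def)
  have carr: "\<phi> a \<in> carrier (G Mod H)" if "a \<in> carrier G" for a
    using hom_in_carrier[OF r_coset_hom_Mod that] by (simp only: \<phi>_def)
  \<comment> \<open>The orders taken in \<open>G\<close> still annihilate the cosets, so the coprime
    exponents carry over to the quotient.\<close>
  have pow: "\<phi> a [^]\<^bsub>G Mod H\<^esub> ord a = \<one>\<^bsub>G Mod H\<^esub>" if "a \<in> carrier G" for a
  proof -
    have "\<phi> a [^]\<^bsub>G Mod H\<^esub> ord a = H #> \<one>"
      unfolding \<phi>_def FactGroup_pow[OF that] using that by simp
    also have "\<dots> = H"
      by (rule coset_join2[OF monoid.one_closed[OF is_monoid] subgroup_axioms subgroup.one_closed[OF subgroup_axioms]])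
    finally show ?thesis by simp
  qed
  have comm: "\<phi> c \<otimes>\<^bsub>G Mod H\<^esub> \<phi> z = \<phi> z \<otimes>\<^bsub>G Mod H\<^esub> \<phi> c" if z: "z \<in> carrier G" for z
    using rcos_mult_commute_iff[OF c z] central[OF z] hom[OF c z] hom[OF z c]
    by (simp only: \<phi>_def c_def)
  have "x \<otimes> y = c \<otimes> (y \<otimes> x)"
    using x y by (simp add: c_def m_assoc inv_cancel_left)
  then have "\<phi> x \<otimes>\<^bsub>G Mod H\<^esub> \<phi> y = \<phi> c \<otimes>\<^bsub>G Mod H\<^esub> (\<phi> y \<otimes>\<^bsub>G Mod H\<^esub> \<phi> x)"
    using hom[OF x y] hom[OF c monoid.m_closed[OF is_monoid y x]] hom[OF y x] by simp
  then have "\<phi> c = \<one>\<^bsub>G Mod H\<^esub>"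
    using Q.central_commutator_eq_one[OF carr[OF x] carr[OF y] carr[OF c] _ comm[OF x] comm[OF y]
        pow[OF x] pow[OF y] cop] by blast
  then show ?thesis
    using coset_join1[OF _ c subgroup_axioms] by (simp only: \<phi>_def c_def one_FactGroup)
qed

text \<open>Once the commutator lies in one term of the series, it is central modulo the next term,
  hence lies there too.\<close>

lemma (in group) commutator_in_lower_central:
  assumes x: "x \<in> carrier G" and y: "y \<in> carrier G" and cop: "coprime (ord x) (ord y)"
  shows "commutator x y \<in> lower_central G n"
proof (induction n)
  case 0
  show ?case using x y by simp
next
  case (Suc n)
  then show ?case
    using normal.commutator_mem_of_central[OF lower_central_normal x y cop]
      commutator_in_lower_central_Suc by blast
qed

lemma (in group) nilpotent_imp_coprime_orders_commute:
  assumes "nilpotent G"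
  shows "coprime_orders_commute G"
  unfolding coprime_orders_commute_def
proof (intro ballI impI)
  fix x y assume xy: "x \<in> carrier G" "y \<in> carrier G" "coprime (ord x) (ord y)"
  obtain n where "lower_central G n = {\<one>}" using assms by (auto simp: nilpotent_def)
  then have "commutator x y = \<one>" using commutator_in_lower_central[OF xy, of n] by simp
  then show "x \<otimes> y = y \<otimes> x" using xy
    by (metis inv_closed inv_solve_right' l_one m_closed)
qed

section \<open>Sylow subgroups when elements of coprime order commute\<close>

definition primary_elements :: "('a, 'b) monoid_scheme \<Rightarrow> nat \<Rightarrow> 'a set" where
  "primary_elements G p = {x \<in> carrier G. \<exists>k. group.ord G x dvd p ^ k}"

lemma (in group) sylow_subgroup_exists:
  assumes "finite (carrier G)" "Factorial_Ring.prime p"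
  shows "\<exists>P. sylow_subgroup G p P"
proof -
  have "order G = p ^ Factorial_Ring.multiplicity p (order G)
      * (order G div p ^ Factorial_Ring.multiplicity p (order G))"
    by (simp add: multiplicity_dvd)
  then show ?thesis
    using sylow_thm[OF assms(2) is_group _ assms(1)] by (auto simp: sylow_subgroup_def)
qed

text \<open>The full power of each prime in \<open>order G\<close> divides \<open>card K\<close>, so
  \<open>order G\<close> does. This reduces claims about the whole group to one Sylow subgroup per
  prime.\<close>

lemma (in group) subgroup_containing_sylows:
  assumes fin: "finite (carrier G)" and K: "subgroup K G"
    and syl: "\<And>p. Factorial_Ring.prime p \<Longrightarrow> \<exists>P. sylow_subgroup G p P \<and> P \<subseteq> K"
  shows "K = carrier G"
proof -
  have finK: "finite K" using K fin finite_subset subgroup.subset by blast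
  have K0: "card K \<noteq> 0" using finK subgroup.one_closed[OF K] by auto
  have "order G dvd card K"
  proof (rule multiplicity_le_imp_dvd)
    show "order G \<noteq> 0" using fin order_gt_0_iff_finite by auto
    fix p :: nat assume p: "Factorial_Ring.prime p"
    then obtain P where P: "sylow_subgroup G p P" "P \<subseteq> K" using syl by blast
    have "subgroup P (G\<lparr>carrier := K\<rparr>)"
      using P K by (auto simp: sylow_subgroup_def intro: subgroup_incl)
    from group.lagrange[OF subgroup_imp_group[OF K] this]
    have "card P dvd card K" by (simp add: order_def) (metis dvd_triv_right)
    then show "Factorial_Ring.multiplicity p (order G) \<le> Factorial_Ring.multiplicity p (card K)"
      using P K0 p by (intro multiplicity_geI) (auto simp: sylow_subgroup_def)
  qed
  then have "card (carrier G) \<le> card K"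
    using K0 by (auto simp: order_def dest: dvd_imp_le)
  then show ?thesis
    using fin subgroup.subset[OF K] by (simp add: card_subset_eq card_mono le_antisym)
qed

lemma (in group) sylow_subset_primary_elements:
  assumes P: "sylow_subgroup G p P"
  shows "P \<subseteq> primary_elements G p"
proof
  fix x assume x: "x \<in> P"
  have sub: "subgroup P G" using P by (simp add: sylow_subgroup_def)
  have "x [^]\<^bsub>G\<lparr>carrier := P\<rparr>\<^esub> card P = \<one>"
    using group.pow_order_eq_1[OF subgroup_imp_group[OF sub]] x by (simp add: order_def)
  then have "x [^] card P = \<one>"
    using nat_pow_consistent[of x "card P" P] by simp
  then show "x \<in> primary_elements G p"
    using P subgroup.mem_carrier[OF sub x]
    by (auto simp: primary_elements_def pow_eq_id sylow_subgroup_def)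
qed

lemma (in group) primary_elements_coprime_ord:
  assumes "Factorial_Ring.prime p" "Factorial_Ring.prime q" "p \<noteq> q"
    and "x \<in> primary_elements G p" "y \<in> primary_elements G q"
  shows "coprime (ord x) (ord y)"
proof -
  obtain k l where kl: "ord x dvd p ^ k" "ord y dvd q ^ l"
    using assms by (auto simp: primary_elements_def)
  have "coprime (p ^ k) (q ^ l)" using assms primes_coprime by auto
  then show ?thesis using kl coprime_divisors by blast
qed

lemma (in group) primary_elements_commute:
  assumes "coprime_orders_commute G" "Factorial_Ring.prime p" "Factorial_Ring.prime q" "p \<noteq> q"
    and "x \<in> primary_elements G p" "y \<in> primary_elements G q"
  shows "x \<otimes> y = y \<otimes> x"
  using assms primary_elements_coprime_ord[OF assms(2-)]
  by (auto simp: coprime_orders_commute_def primary_elements_def)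

lemma (in group) normalizer_memI:
  assumes "P \<subseteq> carrier G" "g \<in> carrier G" "\<And>x. x \<in> P \<Longrightarrow> g \<otimes> x = x \<otimes> g"
  shows "g \<in> normalizer G P"
proof -
  have "g \<otimes> x \<otimes> inv g = x" if "x \<in> P" for x
    using assms that by (simp add: m_assoc subset_iff)
  then have "g <# P #> inv g = P"
    by (auto simp: l_coset_def r_coset_def)
  then show ?thesis using assms by (simp add: normalizer_def stabilizer_def)
qed

text \<open>The normalizer of \<open>P\<close> contains \<open>P\<close> itself and, for every other
  prime, a Sylow subgroup whose elements centralize \<open>P\<close>; so it is the whole
  group.\<close>

lemma (in group) sylow_subgroup_normal:
  assumes fin: "finite (carrier G)" and cc: "coprime_orders_commute G"
    and p: "Factorial_Ring.prime p" and P: "sylow_subgroup G p P"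
  shows "P \<lhd> G"
proof -
  have sub: "subgroup P G" using P by (simp add: sylow_subgroup_def)
  note N = subgroup_in_normalizer[OF sub]
  have "normalizer G P = carrier G"
  proof (rule subgroup_containing_sylows[OF fin normalizer_imp_subgroup])
    show "P \<subseteq> carrier G" using sub subgroup.subset by blast
    fix q :: nat assume q: "Factorial_Ring.prime q"
    show "\<exists>S. sylow_subgroup G q S \<and> S \<subseteq> normalizer G P"
    proof (cases "q = p")
      case True
      have "P \<subseteq> normalizer G P" using subgroup.subset[OF normal_imp_subgroup[OF N]] by simp
      then show ?thesis using True P by blast
    next
      case False
      obtain S where S: "sylow_subgroup G q S" using sylow_subgroup_exists[OF fin q] by blast
      have "S \<subseteq> normalizer G P"
      proof
        fix y assume y: "y \<in> S"
        note yS = subsetD[OF sylow_subset_primary_elements[OF S] y]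
        show "y \<in> normalizer G P"
        proof (rule normalizer_memI)
          show "P \<subseteq> carrier G" using sub subgroup.subset by blast
          show "y \<in> carrier G" using yS by (simp add: primary_elements_def)
          show "y \<otimes> x = x \<otimes> y" if "x \<in> P" for x
            using primary_elements_commute[OF cc q p False yS]
              sylow_subset_primary_elements[OF P] that by blast
        qed
      qed
      then show ?thesis using S by blast
    qed
  qed
  then show ?thesis using N by simp
qed

text \<open>The index of \<open>P\<close> is prime to \<open>p\<close>, while the coset of
  \<open>x\<close> has \<open>p\<close>-power order dividing that index, so this coset is
  trivial.\<close>

lemma (in group) normal_sylow_contains_primary:
  assumes fin: "finite (carrier G)" and p: "Factorial_Ring.prime p"
    and P: "sylow_subgroup G p P" and "P \<lhd> G" and x: "x \<in> primary_elements G p"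
  shows "x \<in> P"
proof -
  interpret normal P G by fact
  interpret Q: group "G Mod P" by (rule factorgroup_is_group)
  have xG: "x \<in> carrier G" using x by (simp add: primary_elements_def)
  have carr: "P #> x \<in> carrier (G Mod P)"
    using hom_in_carrier[OF r_coset_hom_Mod xG] by simp
  obtain k where "ord x dvd p ^ k" using x by (auto simp: primary_elements_def)
  then have "x [^] (p ^ k) = \<one>" using xG by (simp add: pow_eq_id)
  then have "(P #> x) [^]\<^bsub>G Mod P\<^esub> (p ^ k) = \<one>\<^bsub>G Mod P\<^esub>"
    using FactGroup_pow[OF xG, of "p ^ k"] coset_join2[OF monoid.one_closed[OF is_monoid] subgroup_axioms subgroup.one_closed[OF subgroup_axioms]]
    by simp
  then have 1: "Q.ord (P #> x) dvd p ^ k" using Q.pow_eq_id[OF carr] by simp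
  have 2: "Q.ord (P #> x) dvd order (G Mod P)"
    using Q.ord_dvd_group_order[OF carr] .
  have idx: "order (G Mod P) * p ^ Factorial_Ring.multiplicity p (order G) = order G"
    using lagrange[OF subgroup_axioms] P by (simp add: order_def FactGroup_def sylow_subgroup_def)
  have "order G \<noteq> 0" using fin order_gt_0_iff_finite by auto
  have "\<not> p dvd order (G Mod P)"
  proof
    assume "p dvd order (G Mod P)"
    then have "p ^ Suc (Factorial_Ring.multiplicity p (order G)) dvd order G"
      by (subst (2) idx[symmetric]) (simp add: mult_dvd_mono)
    then show False
      using \<open>order G \<noteq> 0\<close> p power_dvd_iff_le_multiplicity[of "order G" p]
      by (metis not_prime_unit not_less_eq_eq order_refl)
  qed
  then have "coprime (p ^ k) (order (G Mod P))"
    using p by (simp add: prime_imp_coprime)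
  then have "Q.ord (P #> x) = 1"
    using 1 2 by (meson coprime_common_divisor_nat)
  then have "P #> x = P" using Q.ord_eq_1[OF carr] by simp
  then show ?thesis using coset_join1[OF _ xG subgroup_axioms] by simp
qed

text \<open>The two inclusions show that every Sylow subgroup is this set; the converse direction
  comes from the existence of some Sylow subgroup.\<close>

lemma (in group) sylow_subgroup_iff:
  assumes "finite (carrier G)" "coprime_orders_commute G" "Factorial_Ring.prime p"
  shows "sylow_subgroup G p P \<longleftrightarrow> P = primary_elements G p"
proof -
  have *: "S = primary_elements G p" if "sylow_subgroup G p S" for S
    using that sylow_subset_primary_elements normal_sylow_contains_primary sylow_subgroup_normal assms
    by blast
  then show ?thesis using sylow_subgroup_exists[OF assms(1,3)] by metis
qed

section \<open>From commuting coprime orders to nilpotency\<close>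

text \<open>Class equation: were the centre trivial, every conjugacy class but that of the identity
  would have size divisible by \<open>p\<close>, making the group order 1 modulo
  \<open>p\<close>.\<close>

lemma (in group) prime_power_order_center:
  assumes p: "Factorial_Ring.prime p" and ord: "order G = p ^ k" "k > 0"
  obtains z where "z \<in> carrier G" "z \<noteq> \<one>" "\<And>y. y \<in> carrier G \<Longrightarrow> z \<otimes> y = y \<otimes> z"
proof (rule ccontr)
  note intro = that
  assume neg: "\<not> thesis"
  define \<phi> where "\<phi> = (\<lambda>g. \<lambda>h\<in>carrier G. g \<otimes> h \<otimes> inv g)"
  interpret A: group_action G "carrier G" \<phi>
    unfolding \<phi>_def by (rule action_by_conjugation)
  have fin: "finite (carrier G)"
    using ord p prime_gt_0_nat[OF p] by (simp flip: order_gt_0_iff_finite)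
  define O' where "O' = orbits G (carrier G) \<phi>"
  have orb: "orbit G \<phi> x = {g \<otimes> x \<otimes> inv g | g. g \<in> carrier G}" if "x \<in> carrier G" for x
    using that by (simp add: orbit_def \<phi>_def)
  have one: "{\<one>} \<in> O'"
    unfolding O'_def orbits_def using orb[OF one_closed] by force
  have finO: "finite O'" unfolding O'_def orbits_def using fin by simp
  have other: "p dvd card S" if S: "S \<in> O' - {{\<one>}}" for S
  proof -
    obtain x where x: "x \<in> carrier G" "S = orbit G \<phi> x" using S by (auto simp: O'_def orbits_def)
    have "card S dvd p ^ k"
      using A.orbit_stabilizer_theorem[OF x(1)] x ord by (metis dvd_triv_left)
    then obtain i where i: "card S = p ^ i" using p by (auto simp: divides_primepow_nat)
    \<comment> \<open>A class with one element consists of a central element, which is the identity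
      by assumption, and that class was removed.\<close>
    have "i \<noteq> 0"
    proof
      assume "i = 0"
      then obtain a where a: "S = {a}" using i by (auto simp: card_1_singleton_iff)
      have mem: "g \<otimes> x \<otimes> inv g = a" if "g \<in> carrier G" for g
        using orb[OF x(1)] a x(2) that by auto
      have "a = x" using mem[OF one_closed] x(1) by simp
      then have "x \<otimes> g = g \<otimes> x" if "g \<in> carrier G" for g
        using mem[OF that] that x(1) \<open>a = x\<close> inv_solve_right[of x "g \<otimes> x" g] by simp
      then have "x = \<one>" using neg intro[OF x(1)] by metis
      then show False using S a \<open>a = x\<close> by simp
    qed
    then show ?thesis using i by simp
  qed
  have "p ^ k = (\<Sum>S\<in>O'. card S)"
    using A.disjoint_sum[OF fin, of "\<lambda>_. 1::nat"] ord by (simp add: O'_def order_def)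
  also have "\<dots> = 1 + (\<Sum>S\<in>O' - {{\<one>}}. card S)"
    using finO one by (subst sum.remove[of _ "{\<one>}"]) auto
  finally have "p ^ k = 1 + (\<Sum>S\<in>O' - {{\<one>}}. card S)" .
  then have "p dvd 1 + (\<Sum>S\<in>O' - {{\<one>}}. card S)" using ord by (metis dvd_power)
  moreover have "p dvd (\<Sum>S\<in>O' - {{\<one>}}. card S)" by (rule dvd_sum) (rule other)
  ultimately have "p dvd 1" using dvd_add_left_iff by blast
  then show False using p by (simp add: prime_nat_iff)
qed

text \<open>This set is the preimage of the centralizer of the coset of \<open>x\<close>. Closure is
  shown by writing the new commutators through conjugates of those already in \<open>H\<close> and
  of their inverses.\<close>

lemma (in normal) subgroup_central_mod:
  assumes x: "x \<in> carrier G"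
  shows "subgroup {y \<in> carrier G. commutator x y \<in> H} G"
proof (rule subgroupI)
  show "{y \<in> carrier G. commutator x y \<in> H} \<noteq> {}"
    using x subgroup.one_closed[OF subgroup_axioms] by (auto intro!: exI[of _ \<one>])
  fix a assume a: "a \<in> {y \<in> carrier G. commutator x y \<in> H}"
  have "commutator x (inv a) = inv a \<otimes> inv (commutator x a) \<otimes> a"
    using a x by (simp add: m_assoc inv_mult_group inv_cancel_left)
  then show "inv a \<in> {y \<in> carrier G. commutator x y \<in> H}"
    using a inv_op_closed1[of a] by simp
  fix b assume b: "b \<in> {y \<in> carrier G. commutator x y \<in> H}"
  have "commutator x (a \<otimes> b) = commutator x a \<otimes> (a \<otimes> commutator x b \<otimes> inv a)"
    using a b x by (simp add: m_assoc inv_mult_group inv_cancel_left)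
  then show "a \<otimes> b \<in> {y \<in> carrier G. commutator x y \<in> H}"
    using a b inv_op_closed2[of a] by simp
qed auto

text \<open>In other words, a nontrivial quotient has a nontrivial centre. For a Sylow subgroup
  \<open>P\<close> outside \<open>H\<close>, the quotient of \<open>P\<close> by
  \<open>H \<inter> P\<close> is a nontrivial \<open>p\<close>-group. A representative
  \<open>x \<in> P\<close> of a nontrivial central coset commutes modulo \<open>H\<close> with
  \<open>P\<close>, and outright with the Sylow subgroups for other primes.\<close>

lemma (in normal) central_mod_exists:
  assumes fin: "finite (carrier G)" and cc: "coprime_orders_commute G" and ne: "H \<noteq> carrier G"
  obtains x where "x \<in> carrier G" "x \<notin> H" "\<And>y. y \<in> carrier G \<Longrightarrow> commutator x y \<in> H"
proof -
  \<comment> \<open>If \<open>H\<close> contained a Sylow subgroup for every prime, it would be the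
    whole group.\<close>
  obtain p where p: "Factorial_Ring.prime p" "\<And>P. sylow_subgroup G p P \<Longrightarrow> \<not> P \<subseteq> H"
    using subgroup_containing_sylows[OF fin subgroup_axioms] ne by blast
  obtain P where P: "sylow_subgroup G p P" using sylow_subgroup_exists[OF fin p(1)] by blast
  have sub: "subgroup P G" using P by (simp add: sylow_subgroup_def)
  interpret P: group "G\<lparr>carrier := P\<rparr>" by (rule subgroup_imp_group[OF sub])
  interpret N: normal "H \<inter> P" "G\<lparr>carrier := P\<rparr>"
    by (rule normal_Int_subgroup[OF sub normal_axioms])
  interpret Q: group "G\<lparr>carrier := P\<rparr> Mod (H \<inter> P)" by (rule N.factorgroup_is_group)
  have idx: "order (G\<lparr>carrier := P\<rparr> Mod (H \<inter> P)) * card (H \<inter> P)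
      = p ^ Factorial_Ring.multiplicity p (order G)"
    using P.lagrange[OF N.subgroup_axioms] P by (simp add: order_def FactGroup_def sylow_subgroup_def)
  then obtain k where k: "order (G\<lparr>carrier := P\<rparr> Mod (H \<inter> P)) = p ^ k"
    using p(1) by (metis divides_primepow_nat dvd_triv_left)
  have "k \<noteq> 0"
  proof
    assume "k = 0"
    then have "card (H \<inter> P) = card P" using idx k P by (simp add: sylow_subgroup_def)
    moreover have "finite P" using sub fin finite_subset subgroup.subset by blast
    ultimately have "H \<inter> P = P" by (simp add: card_subset_eq)
    then show False using p(2)[OF P] by blast
  qed
  then obtain z where z: "z \<in> carrier (G\<lparr>carrier := P\<rparr> Mod (H \<inter> P))"
      "z \<noteq> \<one>\<^bsub>G\<lparr>carrier := P\<rparr> Mod (H \<inter> P)\<^esub>"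
      "\<And>y. y \<in> carrier (G\<lparr>carrier := P\<rparr> Mod (H \<inter> P)) \<Longrightarrow>
        z \<otimes>\<^bsub>G\<lparr>carrier := P\<rparr> Mod (H \<inter> P)\<^esub> y = y \<otimes>\<^bsub>G\<lparr>carrier := P\<rparr> Mod (H \<inter> P)\<^esub> z"
    using Q.prime_power_order_center[OF p(1) k] by blast
  then obtain x where x: "x \<in> P" "z = (H \<inter> P) #>\<^bsub>G\<lparr>carrier := P\<rparr>\<^esub> x"
    by (auto simp: carrier_FactGroup)
  have xG: "x \<in> carrier G" using x sub subgroup.mem_carrier by fast
  have "x \<notin> H"
  proof
    assume "x \<in> H"
    then have "z = H \<inter> P" using P.coset_join2[OF _ N.subgroup_axioms] x by simp
    then show False using z(2) by simp
  qed
  have commP: "commutator x y \<in> H" if y: "y \<in> P" for y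
  proof -
    have "(H \<inter> P) #>\<^bsub>G\<lparr>carrier := P\<rparr>\<^esub> y \<in> carrier (G\<lparr>carrier := P\<rparr> Mod (H \<inter> P))"
      using hom_in_carrier[OF N.r_coset_hom_Mod] y by simp
    from z(3)[OF this]
    have "(H \<inter> P) #>\<^bsub>G\<lparr>carrier := P\<rparr>\<^esub> (x \<otimes> y) = (H \<inter> P) #>\<^bsub>G\<lparr>carrier := P\<rparr>\<^esub> (y \<otimes> x)"
      using N.rcos_sum[of x y] N.rcos_sum[of y x] x y by simp
    then show ?thesis
      using N.rcos_mult_commute_iff[of x y] x y m_inv_consistent[OF sub] by simp
  qed
  have "{y \<in> carrier G. commutator x y \<in> H} = carrier G"
  proof (rule subgroup_containing_sylows[OF fin subgroup_central_mod[OF xG]])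
    fix q :: nat assume q: "Factorial_Ring.prime q"
    show "\<exists>S. sylow_subgroup G q S \<and> S \<subseteq> {y \<in> carrier G. commutator x y \<in> H}"
    proof (cases "q = p")
      case True
      then show ?thesis using P commP subgroup.subset[OF sub] by blast
    next
      case False
      obtain S where S: "sylow_subgroup G q S" using sylow_subgroup_exists[OF fin q] by blast
      have "commutator x y \<in> H" "y \<in> carrier G" if y: "y \<in> S" for y
      proof -
        note yS = subsetD[OF sylow_subset_primary_elements[OF S] y]
        note xP = subsetD[OF sylow_subset_primary_elements[OF P] x(1)]
        show yG: "y \<in> carrier G" using yS by (simp add: primary_elements_def)
        have "x \<otimes> y = y \<otimes> x"
          using primary_elements_commute[OF cc p(1) q False[symmetric] xP yS] .
        then have "commutator x y = \<one>"
          using xG yG by (simp add: m_assoc inv_cancel_left)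
        then show "commutator x y \<in> H" using subgroup.one_closed[OF subgroup_axioms] by simp
      qed
      then show ?thesis using S by blast
    qed
  qed
  then show ?thesis using that xG \<open>x \<notin> H\<close> by blast
qed

text \<open>Enlarging a normal subgroup by the elements that are central modulo it climbs from
  \<open>{\<one>}\<close> to the whole group; the lower central series descends along the same steps.\<close>

lemma (in group) lower_central_subset_normal:
  assumes fin: "finite (carrier G)" and cc: "coprime_orders_commute G"
  shows "N \<lhd> G \<Longrightarrow> \<exists>n. lower_central G n \<subseteq> N"
proof (induction "card (carrier G) - card N" arbitrary: N rule: less_induct)
  case less
  interpret normal N G by fact
  show ?case
  proof (cases "N = carrier G")
    case True
    then show ?thesis by (intro exI[of _ 0]) simp
  next
    case False
    then obtain x where x: "x \<in> carrier G" "x \<notin> N" "\<And>y. y \<in> carrier G \<Longrightarrow> commutator x y \<in> N"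
      using central_mod_exists[OF fin cc] by blast
    \<comment> \<open>\<open>M\<close> is the preimage of the centre of the quotient by
      \<open>N\<close>; the element \<open>x\<close> makes it strictly larger than \<open>N\<close>,
      so the induction hypothesis applies to it.\<close>
    define M where "M = {x \<in> carrier G. \<forall>y\<in>carrier G. commutator x y \<in> N}"
    have sub: "N \<subseteq> M"
    proof
      fix a assume a: "a \<in> N"
      have "commutator a y \<in> N" if "y \<in> carrier G" for y
      proof -
        have "commutator a y = a \<otimes> (y \<otimes> inv a \<otimes> inv y)"
          using a that by (simp add: m_assoc)
        then show ?thesis using a that inv_op_closed2[of y "inv a"] by simp
      qed
      then show "a \<in> M" using a by (simp add: M_def)
    qed
    have subgrp: "subgroup M G"
    proof (rule subgroupI)
      show "M \<noteq> {}" using sub subgroup.one_closed[OF subgroup_axioms] by blast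
      show "M \<subseteq> carrier G" by (auto simp: M_def)
      fix a assume a: "a \<in> M"
      have "commutator (inv a) y \<in> N" if y: "y \<in> carrier G" for y
      proof -
        have "commutator (inv a) y = inv a \<otimes> inv (commutator a y) \<otimes> a"
          using a y by (simp add: M_def m_assoc inv_mult_group inv_cancel_left)
        then show ?thesis using a y inv_op_closed1[of a] by (simp add: M_def)
      qed
      then show "inv a \<in> M" using a by (simp add: M_def)
      fix b assume b: "b \<in> M"
      have "commutator (a \<otimes> b) y \<in> N" if y: "y \<in> carrier G" for y
      proof -
        have "commutator (a \<otimes> b) y = (a \<otimes> commutator b y \<otimes> inv a) \<otimes> commutator a y"
          using a b y by (simp add: M_def m_assoc inv_mult_group inv_cancel_left)
        then show ?thesis using a b y inv_op_closed2[of a] by (simp add: M_def)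
      qed
      then show "a \<otimes> b \<in> M" using a b by (simp add: M_def)
    qed
    have "M \<lhd> G"
    proof (rule normal_invI[OF subgrp])
      fix g a assume g: "g \<in> carrier G" and a: "a \<in> M"
      have aG: "a \<in> carrier G" using a by (simp add: M_def)
      \<comment> \<open>The conjugate of \<open>a\<close> differs from \<open>a\<close> only by the
        inverse of this commutator, which lies in \<open>N\<close> and hence in
        \<open>M\<close>.\<close>
      have "commutator a g \<in> N" using a g by (simp add: M_def)
      then have "inv (commutator a g) \<in> M" using sub by blast
      then have "inv (commutator a g) \<otimes> a \<in> M" using a subgroup.m_closed[OF subgrp] by blast
      also have "inv (commutator a g) \<otimes> a = g \<otimes> a \<otimes> inv g"
        using aG g by (simp add: m_assoc inv_mult_group inv_cancel_left)
      finally show "g \<otimes> a \<otimes> inv g \<in> M" .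
    qed
    moreover have "x \<in> M" using x by (simp add: M_def)
    then have "card N < card M" "card M \<le> card (carrier G)"
      using sub x(2) fin subgroup.subset[OF subgrp]
      by (auto intro!: psubset_card_mono card_mono finite_subset[OF _ fin])
    ultimately obtain n where n: "lower_central G n \<subseteq> M" using less(1)[of M] by (metis diff_less_mono2 less_le_trans)
    have "lower_central G (Suc n) \<subseteq> N"
      unfolding lower_central.simps
      using n by (intro generate_subgroup_incl subgroup_axioms) (auto simp: M_def)
    then show ?thesis by blast
  qed
qed

lemma (in group) coprime_orders_commute_imp_nilpotent:
  assumes "finite (carrier G)" "coprime_orders_commute G"
  shows "nilpotent G"
proof -
  obtain n where "lower_central G n \<subseteq> {\<one>}"
    using lower_central_subset_normal[OF assms one_is_normal] by blast
  then have "lower_central G n = {\<one>}"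
    using subgroup.one_closed[OF normal_imp_subgroup[OF lower_central_normal]] by blast
  then show ?thesis by (auto simp: nilpotent_def)
qed

section \<open>Enhanced power graphs and element orders\<close>

text \<open>Unlike adjacency this admits \<open>x = y\<close>, and it asks for a common cyclic
  overgroup instead of a cyclic generated subgroup; these agree in finite groups because subgroups
  of cyclic groups are cyclic.\<close>

definition jointly_cyclic :: "('a, 'b) monoid_scheme \<Rightarrow> 'a \<Rightarrow> 'a \<Rightarrow> bool" where
  "jointly_cyclic G x y \<longleftrightarrow>
     (\<exists>g\<in>carrier G. x \<in> generate G {g} \<and> y \<in> generate G {g})"

lemma jointly_cyclic_sym: "jointly_cyclic G x y \<Longrightarrow> jointly_cyclic G y x"
  by (auto simp: jointly_cyclic_def)

lemma (in group) jointly_cyclic_refl: "x \<in> carrier G \<Longrightarrow> jointly_cyclic G x x"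
  by (auto simp: jointly_cyclic_def intro!: bexI[of _ x] generate.incl)

text \<open>Division with remainder: the least positive power of \<open>m\<close> lying in
  \<open>K\<close> generates \<open>K\<close>. Since \<open>ord m\<close> is nonzero, such a power
  exists and natural exponents suffice.\<close>

lemma (in group) subgroup_of_cyclic:
  assumes m: "m \<in> carrier G" "ord m \<noteq> 0" and K: "subgroup K G" "K \<subseteq> generate G {m}"
  obtains d where "d \<in> K" "K = generate G {d}"
proof -
  define n where "n = (LEAST n. 0 < n \<and> m [^] (n::nat) \<in> K)"
  have "0 < ord m \<and> m [^] ord m \<in> K"
    using m subgroup.one_closed[OF K(1)] by simp
  then have n: "0 < n" "m [^] n \<in> K"
    unfolding n_def by (metis (mono_tags, lifting) LeastI)+
  have least: "m [^] k \<notin> K" if "0 < k" "k < n" for k :: nat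
    using that not_less_Least[of k "\<lambda>n. 0 < n \<and> m [^] n \<in> K"] by (auto simp: n_def)
  have sub: "generate G {m [^] n} \<subseteq> K"
    using K n by (intro generate_subgroup_incl) auto
  have "K \<subseteq> generate G {m [^] n}"
  proof
    fix z assume z: "z \<in> K"
    then obtain i :: nat where i: "z = m [^] i"
      using K m generate_pow_nat by blast
    define w where "w = (m [^] n) [^] (int (i div n))"
    have w: "w \<in> generate G {m [^] n}"
      unfolding w_def using m by (subst generate_pow) auto
    have wG: "w \<in> carrier G" "w = m [^] (n * (i div n))"
      using m by (simp_all add: w_def int_pow_int nat_pow_pow)
    have "z = w \<otimes> m [^] (i mod n)"
      unfolding i wG(2) using m by (simp add: nat_pow_mult)
    then have "m [^] (i mod n) = inv w \<otimes> z"
      using m wG by (simp add: inv_cancel_left)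
    then have "m [^] (i mod n) \<in> K"
      using z w sub K(1) by (auto intro: subgroup.m_closed subgroup.m_inv_closed)
    then have "i mod n = 0" using least[of "i mod n"] n(1) by auto
    then show "z \<in> generate G {m [^] n}"
      using \<open>z = w \<otimes> m [^] (i mod n)\<close> w wG(1) by simp
  qed
  then show ?thesis using that[of "m [^] n"] n(2) sub by blast
qed

lemma (in group) cyclic_subgroup_generated_iff:
  assumes fin: "finite (carrier G)" and S: "S \<subseteq> carrier G"
  shows "cyclic_group (subgroup_generated G S) \<longleftrightarrow> (\<exists>g\<in>carrier G. S \<subseteq> generate G {g})"
proof
  have carr: "carrier (subgroup_generated G S) = generate G S"
    using S by (simp add: carrier_subgroup_generated Int_absorb1)
  interpret T: group "subgroup_generated G S" by simp
  note sub = generate_is_subgroup[OF S]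
  have gen: "generate G {g} = range (\<lambda>n::int. g [^]\<^bsub>subgroup_generated G S\<^esub> n)"
    if "g \<in> generate G S" for g
    using that generate_pow[of g] subgroup.mem_carrier[OF sub that]
      int_pow_subgroup_generated[of g S] by (auto simp: carr)
  {
    assume "cyclic_group (subgroup_generated G S)"
    then obtain g where g: "g \<in> generate G S" "generate G S = generate G {g}"
      using gen by (metis T.cyclic_group carr)
    then show "\<exists>g\<in>carrier G. S \<subseteq> generate G {g}"
      using subgroup.mem_carrier[OF sub] generate.incl[of _ S G] by blast
  next
    assume "\<exists>g\<in>carrier G. S \<subseteq> generate G {g}"
    then obtain g where g: "g \<in> carrier G" "S \<subseteq> generate G {g}" by blast
    then have "generate G S \<subseteq> generate G {g}"
      by (intro generate_subgroup_incl generate_is_subgroup) auto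
    moreover have "ord g \<noteq> 0" using ord_ge_1[OF fin g(1)] by simp
    ultimately obtain d where "d \<in> generate G S" "generate G S = generate G {d}"
      using subgroup_of_cyclic[OF g(1) _ sub] by metis
    then show "cyclic_group (subgroup_generated G S)"
      using gen[of d] by (metis T.cyclic_group carr)
  }
qed

lemma (in group) epg_adj_iff:
  assumes "finite (carrier G)" "x \<in> carrier G" "y \<in> carrier G"
  shows "epg_adj G x y \<longleftrightarrow> x \<noteq> y \<and> jointly_cyclic G x y"
  using assms by (auto simp: epg_adj_def jointly_cyclic_def cyclic_subgroup_generated_iff)

text \<open>The generated subgroup is the same in \<open>P\<close> as in \<open>G\<close>, so the
  graph of \<open>P\<close> is an induced subgraph.\<close>

lemma (in group) epg_adj_subgroup:
  assumes P: "subgroup P G" and "x \<in> P" "y \<in> P"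
  shows "epg_adj (G\<lparr>carrier := P\<rparr>) x y \<longleftrightarrow> epg_adj G x y"
proof -
  have "P \<inter> {x, y} = {x, y}" "carrier G \<inter> {x, y} = {x, y}"
    using assms subgroup.mem_carrier by fast+
  then have "subgroup_generated (G\<lparr>carrier := P\<rparr>) {x, y} = subgroup_generated G {x, y}"
    using generate_consistent[of "{x, y}" P] assms
    by (simp add: subgroup_generated_def)
  then show ?thesis by (simp add: epg_adj_def)
qed

section \<open>Closed neighbourhoods and maximal cyclic subgroups\<close>

definition cyclic_nbhd :: "('a, 'b) monoid_scheme \<Rightarrow> 'a \<Rightarrow> 'a set" where
  "cyclic_nbhd G x = {y \<in> carrier G. jointly_cyclic G x y}"

definition maximal_cyclic :: "('a, 'b) monoid_scheme \<Rightarrow> 'a \<Rightarrow> bool" where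
  "maximal_cyclic G m \<longleftrightarrow>
     (\<forall>g\<in>carrier G. m \<in> generate G {g} \<longrightarrow> generate G {g} = generate G {m})"

text \<open>Among the generators of cyclic subgroups containing \<open>x\<close> and
  \<open>y\<close>, take one of largest order; orders are bounded by that of the group.\<close>

lemma (in group) maximal_cyclic_exists:
  assumes fin: "finite (carrier G)" and "jointly_cyclic G x y"
  obtains m where "m \<in> carrier G" "x \<in> generate G {m}" "y \<in> generate G {m}" "maximal_cyclic G m"
proof -
  define P where "P g \<longleftrightarrow> g \<in> carrier G \<and> x \<in> generate G {g} \<and> y \<in> generate G {g}" for g
  obtain g0 where "P g0" using assms by (auto simp: jointly_cyclic_def P_def)
  moreover have "\<forall>g. P g \<longrightarrow> ord g < Suc (order G)"
    using fin by (auto simp: P_def ord_le_group_order less_Suc_eq_le)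
  ultimately have "\<exists>m. P m \<and> (\<forall>g. P g \<longrightarrow> ord g \<le> ord m)"
    by (rule ex_has_greatest_nat)
  then obtain m where m: "P m" "\<And>g. P g \<Longrightarrow> ord g \<le> ord m" by blast
  show ?thesis
  proof (rule that[of m], unfold maximal_cyclic_def, safe)
    fix g assume g: "g \<in> carrier G" "m \<in> generate G {g}"
    have sub: "generate G {m} \<subseteq> generate G {g}"
      using g by (intro generate_subgroup_incl generate_is_subgroup) auto
    have "P g" using sub m(1) g(1) by (auto simp: P_def)
    then have "card (generate G {g}) \<le> card (generate G {m})"
      using m(2)[OF \<open>P g\<close>] generate_pow_card[OF g(1)] generate_pow_card[of m] m(1) by (simp add: P_def)
    moreover have "finite (generate G {g})"
      using generate_incl[of "{g}"] g fin finite_subset by blast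
    ultimately have "generate G {m} = generate G {g}"
      using sub by (intro card_seteq)
    then show "y \<in> generate G {m}" if "y \<in> generate G {g}" for y using that by simp
    show "y \<in> generate G {g}" if "y \<in> generate G {m}" for y using that sub by blast
  qed (use m in \<open>auto simp: P_def\<close>)
qed

text \<open>The set \<open>{z. N(x) \<subseteq> N(z)}\<close> is the intersection of the maximal cyclic subgroups containing \<open>x\<close>.\<close>

lemma (in group) cyclic_nbhd_superset_cyclic:
  assumes fin: "finite (carrier G)" and x: "x \<in> carrier G"
  obtains d where "d \<in> carrier G"
    "{z \<in> carrier G. cyclic_nbhd G x \<subseteq> cyclic_nbhd G z} = generate G {d}"
proof -
  define D where "D = {z \<in> carrier G. cyclic_nbhd G x \<subseteq> cyclic_nbhd G z}"
  \<comment> \<open>Such an \<open>m\<close> is in the neighbourhood of \<open>x\<close>, hence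
    shares a cyclic subgroup with \<open>z\<close>; maximality forces that subgroup to be the one
    generated by \<open>m\<close>.\<close>
  have mem: "z \<in> generate G {m}"
    if "z \<in> D" "m \<in> carrier G" "x \<in> generate G {m}" "maximal_cyclic G m" for z m
  proof -
    have "m \<in> cyclic_nbhd G x"
      using that by (auto simp: cyclic_nbhd_def jointly_cyclic_def intro!: bexI[of _ m] generate.incl)
    then have "jointly_cyclic G z m" using that(1) by (auto simp: D_def cyclic_nbhd_def)
    then show ?thesis using that(4) by (auto simp: jointly_cyclic_def maximal_cyclic_def)
  qed
  \<comment> \<open>Membership in every subgroup containing \<open>A\<close> expresses that
    \<open>w\<close> is generated by \<open>A\<close>; one argument then covers both inverses and
    products.\<close>
  have D: "w \<in> D"
    if w: "w \<in> carrier G" "\<And>S. subgroup S G \<Longrightarrow> A \<subseteq> S \<Longrightarrow> w \<in> S" and A: "A \<subseteq> D" for w A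
  proof -
    have "jointly_cyclic G w y" if y: "y \<in> carrier G" "jointly_cyclic G x y" for y
    proof -
      obtain m where m: "m \<in> carrier G" "x \<in> generate G {m}" "y \<in> generate G {m}"
        "maximal_cyclic G m"
        using maximal_cyclic_exists[OF fin y(2)] by blast
      have "w \<in> generate G {m}"
        using m A mem[OF _ m(1,2,4)] by (intro w(2) generate_is_subgroup) auto
      then show ?thesis using m by (auto simp: jointly_cyclic_def)
    qed
    then show ?thesis using w(1) by (auto simp: D_def cyclic_nbhd_def)
  qed
  have DG: "D \<subseteq> carrier G" by (auto simp: D_def)
  have sub: "subgroup D G"
  proof (rule subgroupI[OF DG])
    show "D \<noteq> {}" using x by (auto simp: D_def)
    show "inv a \<in> D" if "a \<in> D" for a
      using that DG by (intro D[of _ "{a}"]) (auto intro: subgroup.m_inv_closed)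
    show "a \<otimes> b \<in> D" if "a \<in> D" "b \<in> D" for a b
      using that DG by (intro D[of _ "{a, b}"]) (auto intro: subgroup.m_closed)
  qed
  obtain m where m: "m \<in> carrier G" "x \<in> generate G {m}" "maximal_cyclic G m"
    using maximal_cyclic_exists[OF fin jointly_cyclic_refl[OF x]] by blast
  have "D \<subseteq> generate G {m}" using mem[OF _ m] by blast
  moreover have "ord m \<noteq> 0" using ord_ge_1[OF fin m(1)] by simp
  ultimately obtain d where "d \<in> D" "D = generate G {d}"
    using subgroup_of_cyclic[OF m(1) _ sub] by metis
  then show ?thesis using that[of d] DG by (auto simp: D_def)
qed

section \<open>Making a graph isomorphism preserve element orders\<close>

text \<open>The right side involves \<open>d\<close> only through \<open>ord d\<close>, so cyclic
  subgroups of equal size have equally many elements of each order, even in different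
  groups.\<close>

lemma (in group) card_ord_eq_in_cyclic:
  assumes d: "d \<in> carrier G" "ord d \<noteq> 0"
  shows "card {z \<in> generate G {d}. ord z = n} =
    card {k \<in> {0..ord d - 1}. (if k = 0 then 1 else ord d div gcd (ord d) k) = n}"
proof -
  have "{z \<in> generate G {d}. ord z = n} =
      (\<lambda>k. d [^] k) ` {k \<in> {0..ord d - 1}. (if k = 0 then 1 else ord d div gcd (ord d) k) = n}"
    unfolding generate_pow_nat[OF d] using ord_elems_inf_carrier[OF d] ord_pow_gen[OF d(1)]
    by auto
  moreover have "inj_on (\<lambda>k. d [^] k)
      {k \<in> {0..ord d - 1}. (if k = 0 then 1 else ord d div gcd (ord d) k) = n}"
    by (rule inj_on_subset[OF ord_inj[OF d(1)]]) auto
  ultimately show ?thesis by (simp add: card_image)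
qed

text \<open>The count over supersets of \<open>N x\<close> is the count over its own fibre plus
  those over strictly larger values of \<open>N\<close>. The latter agree by induction on the number
  of larger values, so they can be subtracted.\<close>

lemma card_fibre_eq_of_card_superset_eq:
  fixes N :: "'a \<Rightarrow> 's set"
  assumes fin: "finite A"
    and eq: "\<And>x. x \<in> A \<Longrightarrow> card {z \<in> A. N x \<subseteq> N z \<and> P z} = card {z \<in> A. N x \<subseteq> N z \<and> Q z}"
  shows "x \<in> A \<Longrightarrow> card {z \<in> A. N z = N x \<and> P z} = card {z \<in> A. N z = N x \<and> Q z}"
proof (induction "card {T \<in> N ` A. N x \<subset> T}" arbitrary: x rule: less_induct)
  case less
  define U where "U = {T \<in> N ` A. N x \<subset> T}"
  have finU: "finite U" using fin by (simp add: U_def)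
  have split: "card {z \<in> A. N x \<subseteq> N z \<and> R z} =
      card {z \<in> A. N z = N x \<and> R z} + (\<Sum>T\<in>U. card {z \<in> A. N z = T \<and> R z})" for R
  proof -
    have "{z \<in> A. N x \<subseteq> N z \<and> R z} =
        {z \<in> A. N z = N x \<and> R z} \<union> (\<Union>T\<in>U. {z \<in> A. N z = T \<and> R z})"
      by (auto simp: U_def)
    moreover have "card (\<Union>T\<in>U. {z \<in> A. N z = T \<and> R z}) = (\<Sum>T\<in>U. card {z \<in> A. N z = T \<and> R z})"
      using fin finU by (intro card_UN_disjoint) auto
    moreover have "card ({z \<in> A. N z = N x \<and> R z} \<union> (\<Union>T\<in>U. {z \<in> A. N z = T \<and> R z})) =
        card {z \<in> A. N z = N x \<and> R z} + card (\<Union>T\<in>U. {z \<in> A. N z = T \<and> R z})"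
      using fin by (intro card_Un_disjoint) (auto simp: U_def)
    ultimately show ?thesis by simp
  qed
  have "card {z \<in> A. N z = T \<and> P z} = card {z \<in> A. N z = T \<and> Q z}" if T: "T \<in> U" for T
  proof -
    obtain y where y: "y \<in> A" "T = N y" "N x \<subset> N y" using T by (auto simp: U_def)
    have "{T \<in> N ` A. N y \<subset> T} \<subset> U" using y by (auto simp: U_def)
    then have "card {T \<in> N ` A. N y \<subset> T} < card U" using finU by (rule psubset_card_mono[rotated])
    then show ?thesis using less(1)[of y] y by (simp add: U_def)
  qed
  then show ?case using eq[OF less(2)] split[of P] split[of Q] by simp
qed

text \<open>Bijections between the fibres of \<open>k\<close> and \<open>l\<close> over the same
  value are chosen separately and glued.\<close>

lemma bij_betw_of_card_fibres_eq:
  assumes fin: "finite A"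
    and eq: "\<And>v. card {z \<in> A. k z = v} = card {z \<in> A. l z = v}"
  obtains g where "bij_betw g A A" "\<And>z. z \<in> A \<Longrightarrow> l (g z) = k z"
proof -
  have "\<exists>b. bij_betw b {z \<in> A. k z = v} {z \<in> A. l z = v}" for v
    using fin eq by (intro finite_same_card_bij) auto
  then obtain b where b: "\<And>v. bij_betw (b v) {z \<in> A. k z = v} {z \<in> A. l z = v}" by metis
  define g where "g z = b (k z) z" for z
  have g: "g z \<in> A" "l (g z) = k z" if "z \<in> A" for z
    using bij_betwE[OF b[of "k z"]] that by (auto simp: g_def)
  have "inj_on g A"
  proof (rule inj_onI)
    fix y z assume yz: "y \<in> A" "z \<in> A" "g y = g z"
    then have "k y = k z" using g by metis
    then show "y = z" using yz bij_betw_imp_inj_on[OF b[of "k y"]] by (auto simp: g_def inj_on_def)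
  qed
  moreover have "g ` A \<subseteq> A" using g by blast
  ultimately have "bij_betw g A A" using fin by (simp add: bij_betw_def endo_inj_surj)
  then show ?thesis using that g by blast
qed

text \<open>The given \<open>f\<close> may change orders, but only by rearranging them among
  elements with the same closed neighbourhood. Precomposing with a permutation \<open>g\<close>
  inside these fibres repairs this without affecting joint cyclicity.\<close>

lemma jointly_cyclic_iso_preserving_ord:
  assumes "group G" "finite (carrier G)" "group H" "finite (carrier H)"
    and f: "bij_betw f (carrier G) (carrier H)"
    and iso: "\<And>x y. x \<in> carrier G \<Longrightarrow> y \<in> carrier G \<Longrightarrow>
      jointly_cyclic G x y \<longleftrightarrow> jointly_cyclic H (f x) (f y)"
  obtains h where "bij_betw h (carrier G) (carrier H)"
    "\<And>x y. x \<in> carrier G \<Longrightarrow> y \<in> carrier G \<Longrightarrow>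
      jointly_cyclic G x y \<longleftrightarrow> jointly_cyclic H (h x) (h y)"
    "\<And>x. x \<in> carrier G \<Longrightarrow> group.ord H (h x) = group.ord G x"
proof -
  interpret G: group G by fact
  interpret H: group H by fact
  note fin = \<open>finite (carrier G)\<close> \<open>finite (carrier H)\<close>
  have img: "f ` carrier G = carrier H" and inj: "inj_on f (carrier G)"
    using f by (auto simp: bij_betw_def)
  have nbhd: "cyclic_nbhd H (f x) = f ` cyclic_nbhd G x" if "x \<in> carrier G" for x
    using that iso img by (force simp: cyclic_nbhd_def)
  have sub: "cyclic_nbhd H (f x) \<subseteq> cyclic_nbhd H (f z) \<longleftrightarrow> cyclic_nbhd G x \<subseteq> cyclic_nbhd G z"
    if "x \<in> carrier G" "z \<in> carrier G" for x z
    unfolding nbhd[OF that(1)] nbhd[OF that(2)]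
    using inj_on_image_mem_iff[OF inj, of _ "cyclic_nbhd G z"]
    by (auto simp: image_subset_iff cyclic_nbhd_def)
  \<comment> \<open>The elements whose neighbourhood contains that of \<open>x\<close> form a cyclic
    subgroup, and \<open>f\<close> maps it onto the corresponding one of \<open>H\<close>. The two
    have equal size, hence equal numbers of elements of order \<open>n\<close>.\<close>
  have D: "card {z \<in> carrier G. cyclic_nbhd G x \<subseteq> cyclic_nbhd G z \<and> G.ord z = n} =
      card {z \<in> carrier G. cyclic_nbhd G x \<subseteq> cyclic_nbhd G z \<and> H.ord (f z) = n}"
    if x: "x \<in> carrier G" for x n
  proof -
    have fx: "f x \<in> carrier H" using x img by blast
    obtain d where d: "d \<in> carrier G"
        "{z \<in> carrier G. cyclic_nbhd G x \<subseteq> cyclic_nbhd G z} = generate G {d}"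
      using G.cyclic_nbhd_superset_cyclic[OF fin(1) x] by blast
    obtain e where e: "e \<in> carrier H"
        "{z \<in> carrier H. cyclic_nbhd H (f x) \<subseteq> cyclic_nbhd H z} = generate H {e}"
      using H.cyclic_nbhd_superset_cyclic[OF fin(2) fx] by blast
    have fd: "f ` generate G {d} = generate H {e}"
      unfolding d(2)[symmetric] e(2)[symmetric]
    proof (intro equalityI subsetI)
      fix w assume "w \<in> f ` {z \<in> carrier G. cyclic_nbhd G x \<subseteq> cyclic_nbhd G z}"
      then show "w \<in> {z \<in> carrier H. cyclic_nbhd H (f x) \<subseteq> cyclic_nbhd H z}"
        using sub[OF x] img by auto
    next
      fix w assume w: "w \<in> {z \<in> carrier H. cyclic_nbhd H (f x) \<subseteq> cyclic_nbhd H z}"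
      then obtain z where z: "z \<in> carrier G" "w = f z" using img by blast
      then show "w \<in> f ` {z \<in> carrier G. cyclic_nbhd G x \<subseteq> cyclic_nbhd G z}"
        using w sub[OF x z(1)] by simp
    qed
    have genG: "generate G {d} \<subseteq> carrier G" using d(2) by blast
    have injd: "inj_on f (generate G {d})"
      using inj genG inj_on_subset by blast
    have "G.ord d = H.ord e"
      using card_image[OF injd] fd G.generate_pow_card[OF d(1)] H.generate_pow_card[OF e(1)] by simp
    then have "card {z \<in> generate G {d}. G.ord z = n} = card {w \<in> generate H {e}. H.ord w = n}"
      using G.card_ord_eq_in_cyclic[OF d(1)] H.card_ord_eq_in_cyclic[OF e(1)]
        G.ord_ge_1[OF fin(1) d(1)] H.ord_ge_1[OF fin(2) e(1)] by simp
    also have "{w \<in> generate H {e}. H.ord w = n} = f ` {z \<in> generate G {d}. H.ord (f z) = n}"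
      unfolding fd[symmetric] by auto
    also have "card \<dots> = card {z \<in> generate G {d}. H.ord (f z) = n}"
      by (intro card_image inj_on_subset[OF injd]) auto
    finally show ?thesis unfolding d(2)[symmetric] by (simp add: conj_assoc)
  qed
  \<comment> \<open>Pairing the neighbourhood with the order makes the permutation obtained from
    these counts fix neighbourhoods while matching orders. If \<open>fst v\<close> is no
    neighbourhood, both sets are empty.\<close>
  have E: "card {z \<in> carrier G. (cyclic_nbhd G z, G.ord z) = v} =
      card {z \<in> carrier G. (cyclic_nbhd G z, H.ord (f z)) = v}" for v
  proof (cases "\<exists>x\<in>carrier G. cyclic_nbhd G x = fst v")
    case True
    then obtain x where x: "x \<in> carrier G" "cyclic_nbhd G x = fst v" by blast
    show ?thesis
      using card_fibre_eq_of_card_superset_eq[OF fin(1) D x(1), of "snd v"] x(2)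
      by (simp add: prod_eq_iff)
  next
    case False
    then have "{z \<in> carrier G. (cyclic_nbhd G z, G.ord z) = v} = {}"
      "{z \<in> carrier G. (cyclic_nbhd G z, H.ord (f z)) = v} = {}" by auto
    then show ?thesis by (simp only:)
  qed
  obtain g where g: "bij_betw g (carrier G) (carrier G)"
      "\<And>z. z \<in> carrier G \<Longrightarrow> (cyclic_nbhd G (g z), H.ord (f (g z))) = (cyclic_nbhd G z, G.ord z)"
    using bij_betw_of_card_fibres_eq[OF fin(1) E] by blast
  have gG: "g x \<in> carrier G" if "x \<in> carrier G" for x
    using g(1) that bij_betwE by fast
  have step: "jointly_cyclic G (g x) y \<longleftrightarrow> jointly_cyclic G x y"
    if "x \<in> carrier G" "y \<in> carrier G" for x y
    using g(2)[OF that(1)] that(2) by (auto simp: cyclic_nbhd_def)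
  show ?thesis
  proof (rule that[of "f \<circ> g"])
    show "bij_betw (f \<circ> g) (carrier G) (carrier H)" using bij_betw_trans[OF g(1) f] .
    show "jointly_cyclic G x y \<longleftrightarrow> jointly_cyclic H ((f \<circ> g) x) ((f \<circ> g) y)"
      if "x \<in> carrier G" "y \<in> carrier G" for x y
      using step[of x "g y"] step[of y x] iso[of "g x" "g y"] gG that jointly_cyclic_sym
      by (metis comp_apply)
    show "H.ord ((f \<circ> g) x) = G.ord x" if "x \<in> carrier G" for x
      using g(2)[OF that] by simp
  qed
qed

text \<open>A bijection respects equality, so adding loops to the edge relation changes nothing, and
  joint cyclicity may be taken in the ambient groups.\<close>

lemma epg_iso_subgroup_iff:
  assumes "group G" "finite (carrier G)" "subgroup P G"
    and "group H" "finite (carrier H)" "subgroup Q H"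
  shows "epg_iso (G\<lparr>carrier := P\<rparr>) (H\<lparr>carrier := Q\<rparr>) \<longleftrightarrow>
    (\<exists>f. bij_betw f P Q \<and>
      (\<forall>x\<in>P. \<forall>y\<in>P. jointly_cyclic G x y \<longleftrightarrow> jointly_cyclic H (f x) (f y)))"
proof -
  interpret G: group G by fact
  interpret H: group H by fact
  have "(epg_adj (G\<lparr>carrier := P\<rparr>) x y \<longleftrightarrow> epg_adj (H\<lparr>carrier := Q\<rparr>) (f x) (f y))
      \<longleftrightarrow> (jointly_cyclic G x y \<longleftrightarrow> jointly_cyclic H (f x) (f y))"
    if f: "bij_betw f P Q" and xy: "x \<in> P" "y \<in> P" for f x y
  proof -
    have fxy: "f x \<in> Q" "f y \<in> Q" using f xy bij_betwE by fast+
    have inG: "x \<in> carrier G" "y \<in> carrier G" and inH: "f x \<in> carrier H" "f y \<in> carrier H"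
      using xy fxy assms(3,6) subgroup.mem_carrier by fast+
    have "f x = f y \<longleftrightarrow> x = y" using f xy by (auto simp: bij_betw_def inj_on_def)
    then show ?thesis
      using G.epg_adj_subgroup[OF assms(3) xy] H.epg_adj_subgroup[OF assms(6) fxy]
        G.epg_adj_iff[OF assms(2) inG] H.epg_adj_iff[OF assms(5) inH]
        G.jointly_cyclic_refl[OF inG(1)] H.jointly_cyclic_refl[OF inH(1)] by auto
  qed
  then show ?thesis by (simp add: epg_iso_def cong: conj_cong)
qed

lemma epg_iso_iff:
  assumes "group G" "finite (carrier G)" "group H" "finite (carrier H)"
  shows "epg_iso G H \<longleftrightarrow>
    (\<exists>f. bij_betw f (carrier G) (carrier H) \<and>
      (\<forall>x\<in>carrier G. \<forall>y\<in>carrier G. jointly_cyclic G x y \<longleftrightarrow> jointly_cyclic H (f x) (f y)))"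
  using epg_iso_subgroup_iff[OF assms(1,2) group.subgroup_self[OF assms(1)]
      assms(3,4) group.subgroup_self[OF assms(3)]] by simp

lemma (in group) pow_cong:
  assumes x: "x \<in> carrier G" "x [^] (m::nat) = \<one>" and ab: "[a = b] (mod m)"
  shows "x [^] a = x [^] b"
proof -
  have "x [^] k = x [^] (k mod m)" for k
  proof -
    have "x [^] k = x [^] (m * (k div m)) \<otimes> x [^] (k mod m)"
      using x(1) by (simp add: nat_pow_mult)
    also have "x [^] (m * (k div m)) = \<one>"
      using x by (simp flip: nat_pow_pow)
    finally show ?thesis using x(1) by simp
  qed
  then show ?thesis using ab by (metis cong_def)
qed

lemma (in group) jointly_cyclic_iff_pow:
  assumes fin: "finite (carrier G)"
  shows "jointly_cyclic G x y \<longleftrightarrow> (\<exists>g\<in>carrier G. \<exists>(i::nat) (j::nat). x = g [^] i \<and> y = g [^] j)"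
proof -
  have "generate G {g} = {g [^] k |k. k \<in> (UNIV :: nat set)}" if "g \<in> carrier G" for g
    using generate_pow_nat[OF that] ord_ge_1[OF fin that] by simp
  then show ?thesis unfolding jointly_cyclic_def by (intro bex_cong) auto
qed

lemma (in group) jointly_cyclic_imp_commute:
  assumes "finite (carrier G)" "jointly_cyclic G x y"
  shows "x \<otimes> y = y \<otimes> x"
  using assms by (auto simp: jointly_cyclic_iff_pow nat_pow_mult add.commute)

text \<open>The product \<open>x \<otimes> y\<close> is a common generator: exponents from the
  Chinese remainder theorem recover each factor as a power of it.\<close>

lemma (in group) commute_coprime_imp_jointly_cyclic:
  assumes fin: "finite (carrier G)" and x: "x \<in> carrier G" and y: "y \<in> carrier G"
    and cop: "coprime (ord x) (ord y)" and comm: "x \<otimes> y = y \<otimes> x"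
  shows "jointly_cyclic G x y"
proof -
  obtain a where a: "[a = 1] (mod ord x)" "[a = 0] (mod ord y)"
    using binary_chinese_remainder_nat[OF cop] by blast
  obtain b where b: "[b = 0] (mod ord x)" "[b = 1] (mod ord y)"
    using binary_chinese_remainder_nat[OF cop] by blast
  have "(x \<otimes> y) [^] k = x [^] k \<otimes> y [^] k" for k :: nat
    using pow_mult_distrib[OF comm x y] .
  then have "(x \<otimes> y) [^] a = x" "(x \<otimes> y) [^] b = y"
    using pow_cong[OF x _ a(1)] pow_cong[OF y _ a(2)] pow_cong[OF x _ b(1)] pow_cong[OF y _ b(2)] x y
    by simp_all
  then show ?thesis
    unfolding jointly_cyclic_iff_pow[OF fin] using x y by (metis m_closed)
qed

section \<open>Primary components\<close>

text \<open>For positive \<open>n\<close> these are the orthogonal idempotents of the integers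
  modulo \<open>n\<close>. If \<open>n\<close> annihilates \<open>x\<close>, then
  \<open>x [^] e p\<close> is the \<open>p\<close>-part of \<open>x\<close>.\<close>

definition idempotent_exponents :: "nat \<Rightarrow> (nat \<Rightarrow> nat) \<Rightarrow> bool" where
  "idempotent_exponents n e \<longleftrightarrow>
     (\<forall>p\<in>prime_factors n. \<forall>q\<in>prime_factors n.
        [e p = (if q = p then 1 else 0)] (mod q ^ Factorial_Ring.multiplicity q n))"

lemma idempotent_exponentsD:
  assumes "idempotent_exponents n e" "p \<in> prime_factors n" "q \<in> prime_factors n"
  shows "[e p = (if q = p then 1 else 0)] (mod q ^ Factorial_Ring.multiplicity q n)"
  using assms unfolding idempotent_exponents_def by blast

lemma coprime_prime_factor_powers:
  "\<lbrakk>p \<in> prime_factors n; q \<in> prime_factors n; p \<noteq> q\<rbrakk>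
    \<Longrightarrow> coprime (p ^ i) (q ^ j :: nat)"
  by (simp add: in_prime_factors_iff primes_coprime)

lemma idempotent_exponents_exist: "\<exists>e. idempotent_exponents n e"
proof -
  have "\<exists>x. \<forall>q\<in>prime_factors n. [x = (if q = p then 1 else 0)] (mod q ^ Factorial_Ring.multiplicity q n)" for p
    by (rule chinese_remainder_nat) (simp, blast intro: coprime_prime_factor_powers)
  then show ?thesis unfolding idempotent_exponents_def by metis
qed

lemma cong_of_cong_prime_powers:
  fixes a b n :: nat
  assumes "n > 0"
    and "\<And>q. q \<in> prime_factors n \<Longrightarrow> [a = b] (mod q ^ Factorial_Ring.multiplicity q n)"
  shows "[a = b] (mod n)"
proof -
  have "[a = b] (mod (\<Prod>q\<in>prime_factors n. q ^ Factorial_Ring.multiplicity q n))"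
    using assms(2) by (intro coprime_cong_prod_nat coprime_prime_factor_powers)
  then show ?thesis using prime_factorization_nat[of n] assms(1) by simp
qed

text \<open>Any common exponent \<open>n\<close> is allowed, not just the group order, so that two
  groups can share the same \<open>n\<close> and \<open>e\<close>.\<close>

locale primary_decomposition = group G for G (structure) +
  fixes n :: nat and e :: "nat \<Rightarrow> nat"
  assumes finite_carrier: "finite (carrier G)"
    and coprime_commute: "coprime_orders_commute G"
    and n_pos: "n > 0"
    and pow_n: "x \<in> carrier G \<Longrightarrow> x [^] n = \<one>"
    and exponents: "idempotent_exponents n e"
begin

lemma primary_closed: "x \<in> primary_elements G p \<Longrightarrow> x \<in> carrier G"
  by (simp add: primary_elements_def)

text \<open>Modulo the \<open>q\<close>-part of \<open>n\<close>, the number \<open>e p\<close>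
  vanishes for \<open>q \<noteq> p\<close>, and the power of \<open>p\<close> vanishes for
  \<open>q = p\<close>; so their product annihilates \<open>x\<close>.\<close>

lemma projection_primary:
  assumes x: "x \<in> carrier G" and p: "p \<in> prime_factors n"
  shows "x [^] e p \<in> primary_elements G p"
proof -
  have "[e p * p ^ Factorial_Ring.multiplicity p n = 0] (mod n)"
  proof (rule cong_of_cong_prime_powers[OF n_pos])
    fix q assume q: "q \<in> prime_factors n"
    show "[e p * p ^ Factorial_Ring.multiplicity p n = 0] (mod q ^ Factorial_Ring.multiplicity q n)"
    proof (cases "q = p")
      case False
      then have "[e p = 0] (mod q ^ Factorial_Ring.multiplicity q n)"
        using idempotent_exponentsD[OF exponents p q] by simp
      then show ?thesis by (simp add: cong_0_iff)
    qed (simp add: cong_0_iff)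
  qed
  then have "x [^] (e p * p ^ Factorial_Ring.multiplicity p n) = x [^] (0::nat)"
    using pow_cong[OF x pow_n[OF x]] by blast
  then have "(x [^] e p) [^] (p ^ Factorial_Ring.multiplicity p n) = \<one>"
    using x by (simp add: nat_pow_pow)
  then show ?thesis using x by (auto simp: primary_elements_def pow_eq_id)
qed

lemma primary_pow:
  assumes p: "p \<in> prime_factors n" and x: "x \<in> primary_elements G p"
  shows "x [^] (p ^ Factorial_Ring.multiplicity p n) = \<one>"
proof -
  have xG: "x \<in> carrier G" using x primary_closed by blast
  have pp: "Factorial_Ring.prime p" using p by auto
  obtain k where "ord x dvd p ^ k" using x by (auto simp: primary_elements_def)
  then obtain i where i: "ord x = p ^ i" using pp by (auto simp: divides_primepow_nat)
  have "ord x dvd n" using pow_n[OF xG] pow_eq_id[OF xG] by simp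
  then have "i \<le> Factorial_Ring.multiplicity p n"
    using i pp n_pos by (intro multiplicity_geI) (auto simp: prime_nat_iff)
  then show ?thesis using i pow_eq_id[OF xG] by (simp add: le_imp_power_dvd)
qed

lemma primary_pow_cong:
  assumes "p \<in> prime_factors n" "x \<in> primary_elements G p"
    and "[a = b] (mod p ^ Factorial_Ring.multiplicity p n)"
  shows "x [^] a = x [^] b"
  using pow_cong[OF primary_closed[OF assms(2)] primary_pow[OF assms(1,2)] assms(3)] .

lemma projection_of_primary:
  assumes "p \<in> prime_factors n" "q \<in> prime_factors n" and x: "x \<in> primary_elements G p"
  shows "x [^] e q = (if p = q then x else \<one>)"
proof -
  have "[e q = (if p = q then 1 else 0)] (mod p ^ Factorial_Ring.multiplicity p n)"
    using idempotent_exponentsD[OF exponents assms(2,1)] by simp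
  from primary_pow_cong[OF assms(1) x this] show ?thesis
    using primary_closed[OF x] by (auto split: if_splits)
qed

text \<open>The idempotents sum to 1 modulo \<open>n\<close>, so an element is the product of its
  projections.\<close>

lemma projections_eq_imp_eq:
  assumes x: "x \<in> carrier G" and y: "y \<in> carrier G"
    and eq: "\<And>p. p \<in> prime_factors n \<Longrightarrow> x [^] e p = y [^] e p"
  shows "x = y"
proof -
  have "[(\<Sum>p\<in>prime_factors n. e p) = 1] (mod n)"
  proof (rule cong_of_cong_prime_powers[OF n_pos])
    fix q assume q: "q \<in> prime_factors n"
    have "[(\<Sum>p\<in>prime_factors n. e p) = (\<Sum>p\<in>prime_factors n. if q = p then 1 else 0)]
        (mod q ^ Factorial_Ring.multiplicity q n)"
      using exponents q by (intro cong_sum idempotent_exponentsD)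
    then show "[(\<Sum>p\<in>prime_factors n. e p) = 1] (mod q ^ Factorial_Ring.multiplicity q n)"
      using q by simp
  qed
  then have sum: "z [^] (\<Sum>p\<in>prime_factors n. e p) = z" if "z \<in> carrier G" for z
    using pow_cong[OF that pow_n[OF that]] that by (metis nat_pow_eone)
  have "finite S \<Longrightarrow> S \<subseteq> prime_factors n \<Longrightarrow>
      x [^] (\<Sum>p\<in>S. e p) = y [^] (\<Sum>p\<in>S. e p)" for S
    by (induction S rule: finite_induct) (use x y eq in \<open>simp_all flip: nat_pow_mult\<close>)
  then have "x [^] (\<Sum>p\<in>prime_factors n. e p) = y [^] (\<Sum>p\<in>prime_factors n. e p)" by simp
  then show ?thesis using sum x y by simp
qed

lemma projections_surj:
  assumes a: "\<And>p. p \<in> prime_factors n \<Longrightarrow> a p \<in> primary_elements G p"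
  shows "\<exists>y\<in>carrier G. \<forall>p\<in>prime_factors n. y [^] e p = a p"
proof -
  \<comment> \<open>The components are multiplied in one prime at a time, with trivial projections
    prescribed outside \<open>S\<close>.\<close>
  have "finite S \<Longrightarrow> S \<subseteq> prime_factors n \<Longrightarrow>
      \<exists>y\<in>carrier G. \<forall>p\<in>prime_factors n. y [^] e p = (if p \<in> S then a p else \<one>)" for S
  proof (induction S rule: finite_induct)
    case empty
    show ?case by (intro bexI[of _ \<one>]) auto
  next
    case (insert q S)
    then obtain y where y: "y \<in> carrier G"
        "\<And>p. p \<in> prime_factors n \<Longrightarrow> y [^] e p = (if p \<in> S then a p else \<one>)" by auto
    have q: "q \<in> prime_factors n" using insert by simp
    have aq: "a q \<in> primary_elements G q" "a q \<in> carrier G"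
      using a[OF q] primary_closed by auto
    \<comment> \<open>The \<open>q\<close>-projection of \<open>y\<close> is still trivial, so
      \<open>ord y\<close> divides \<open>e q\<close>, which is 1 modulo the \<open>q\<close>-part
      of \<open>n\<close>. Hence \<open>y\<close> and \<open>a q\<close> have coprime orders and
      commute.\<close>
    have "ord y dvd e q" using y q insert.hyps(2) pow_eq_id[OF y(1), of "e q"] by auto
    moreover have "[e q = 1] (mod q ^ Factorial_Ring.multiplicity q n)"
      using idempotent_exponentsD[OF exponents q q] by simp
    then have "coprime (e q) (q ^ Factorial_Ring.multiplicity q n)"
      using cong_imp_coprime cong_sym coprime_1_left by blast
    moreover have "ord (a q) dvd q ^ Factorial_Ring.multiplicity q n"
      using primary_pow[OF q aq(1)] pow_eq_id[OF aq(2)] by simp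
    ultimately have "coprime (ord y) (ord (a q))" using coprime_divisors by blast
    then have comm: "y \<otimes> a q = a q \<otimes> y"
      using coprime_commute y(1) aq(2) unfolding coprime_orders_commute_def by blast
    have "(y \<otimes> a q) [^] e p = (if p \<in> insert q S then a p else \<one>)"
      if p: "p \<in> prime_factors n" for p
      using pow_mult_distrib[OF comm y(1) aq(2), of "e p"] y(2)[OF p]
        projection_of_primary[OF q p aq(1)] insert.hyps(2) aq(2) primary_closed[OF a[OF p]]
      by (auto split: if_splits)
    then show ?case using y(1) aq(2) by (metis m_closed)
  qed
  from this[of "prime_factors n"] show ?thesis by simp
qed

text \<open>Forwards, projections are powers. Backwards, the projected generators for the separate
  primes assemble to one element \<open>c\<close>, and the Chinese remainder theorem merges the
  exponents.\<close>

lemma jointly_cyclic_iff_projections: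
  assumes x: "x \<in> carrier G" and y: "y \<in> carrier G"
  shows "jointly_cyclic G x y \<longleftrightarrow>
    (\<forall>p\<in>prime_factors n. jointly_cyclic G (x [^] e p) (y [^] e p))"
proof
  assume "jointly_cyclic G x y"
  then obtain g and i j :: nat where g: "g \<in> carrier G" "x = g [^] i" "y = g [^] j"
    unfolding jointly_cyclic_iff_pow[OF finite_carrier] by metis
  then have "x [^] e p = g [^] (i * e p)" "y [^] e p = g [^] (j * e p)" for p
    by (simp_all add: nat_pow_pow)
  then show "\<forall>p\<in>prime_factors n. jointly_cyclic G (x [^] e p) (y [^] e p)"
    unfolding jointly_cyclic_iff_pow[OF finite_carrier] using g(1) by blast
next
  assume "\<forall>p\<in>prime_factors n. jointly_cyclic G (x [^] e p) (y [^] e p)"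
  then obtain g i j where g: "\<And>p. p \<in> prime_factors n \<Longrightarrow> g p \<in> carrier G"
      "\<And>p. p \<in> prime_factors n \<Longrightarrow> x [^] e p = g p [^] (i p :: nat)"
      "\<And>p. p \<in> prime_factors n \<Longrightarrow> y [^] e p = g p [^] (j p :: nat)"
    unfolding jointly_cyclic_iff_pow[OF finite_carrier] by metis
  have gp: "g p [^] e p \<in> primary_elements G p" if "p \<in> prime_factors n" for p
    using projection_primary[OF g(1)[OF that] that] .
  obtain c where c: "c \<in> carrier G" "\<And>p. p \<in> prime_factors n \<Longrightarrow> c [^] e p = g p [^] e p"
    using projections_surj[of "\<lambda>p. g p [^] e p", OF gp] by blast
  have "\<exists>k::nat. z = c [^] k"
    if z: "z \<in> carrier G" and zi: "\<And>p. p \<in> prime_factors n \<Longrightarrow> z [^] e p = g p [^] i p" for z and i :: "nat \<Rightarrow> nat"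
  proof -
    have "\<exists>k. \<forall>p\<in>prime_factors n. [k = i p] (mod p ^ Factorial_Ring.multiplicity p n)"
      by (rule chinese_remainder_nat) (simp, blast intro: coprime_prime_factor_powers)
    then obtain k where k: "\<And>p. p \<in> prime_factors n \<Longrightarrow> [k = i p] (mod p ^ Factorial_Ring.multiplicity p n)"
      by blast
    have "z = c [^] k"
    proof (rule projections_eq_imp_eq[OF z nat_pow_closed[OF c(1)]])
      fix p assume p: "p \<in> prime_factors n"
      \<comment> \<open>Projecting twice replaces \<open>g p\<close>, an arbitrary element, by its
        \<open>p\<close>-part, where exponents matter only modulo the \<open>p\<close>-part of
        \<open>n\<close>.\<close>
      have "z [^] e p = (z [^] e p) [^] e p"
        using projection_of_primary[OF p p projection_primary[OF z p]] by simp
      also have "\<dots> = (g p [^] e p) [^] i p"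
        unfolding zi[OF p] using g(1)[OF p] by (simp add: nat_pow_pow mult.commute)
      also have "\<dots> = (g p [^] e p) [^] k"
        using primary_pow_cong[OF p gp[OF p] k[OF p]] by simp
      also have "\<dots> = (c [^] k) [^] e p"
        using c(1) by (simp add: nat_pow_pow mult.commute flip: c(2)[OF p])
      finally show "z [^] e p = (c [^] k) [^] e p" .
    qed
    then show ?thesis by blast
  qed
  from this[OF x g(2)] this[OF y g(3)] show "jointly_cyclic G x y"
    unfolding jointly_cyclic_iff_pow[OF finite_carrier] using c(1) by blast
qed

end

section \<open>Passing between the whole graph and its primary components\<close>

text \<open>Elements correspond to families of primary projections, so applying \<open>f p\<close>
  in each component defines a bijection, and joint cyclicity is tested componentwise.\<close>

lemma glue_primary_isos:
  assumes G: "primary_decomposition G n e" and H: "primary_decomposition H n e"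
    and f: "\<And>p. p \<in> prime_factors n \<Longrightarrow>
      bij_betw (f p) (primary_elements G p) (primary_elements H p)"
    and jc: "\<And>p x y. p \<in> prime_factors n \<Longrightarrow> x \<in> primary_elements G p \<Longrightarrow>
      y \<in> primary_elements G p \<Longrightarrow>
      jointly_cyclic G x y \<longleftrightarrow> jointly_cyclic H (f p x) (f p y)"
  shows "epg_iso G H"
proof -
  interpret G: primary_decomposition G n e by fact
  interpret H: primary_decomposition H n e by fact
  have f_mem: "f p x \<in> primary_elements H p"
    if "p \<in> prime_factors n" "x \<in> primary_elements G p" for p x
    using bij_betwE[OF f[OF that(1)]] that(2) by blast
  have "\<exists>y\<in>carrier H. \<forall>p\<in>prime_factors n. y [^]\<^bsub>H\<^esub> e p = f p (x [^]\<^bsub>G\<^esub> e p)"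
    if "x \<in> carrier G" for x
    using f_mem G.projection_primary[OF that] by (intro H.projections_surj) auto
  then obtain h where h: "\<And>x. x \<in> carrier G \<Longrightarrow> h x \<in> carrier H"
      "\<And>x p. x \<in> carrier G \<Longrightarrow> p \<in> prime_factors n \<Longrightarrow> h x [^]\<^bsub>H\<^esub> e p = f p (x [^]\<^bsub>G\<^esub> e p)"
    by metis
  have "inj_on h (carrier G)"
  proof (rule inj_onI, rule G.projections_eq_imp_eq)
    fix x y p assume xy: "x \<in> carrier G" "y \<in> carrier G" "h x = h y" and p: "p \<in> prime_factors n"
    then have "f p (x [^]\<^bsub>G\<^esub> e p) = f p (y [^]\<^bsub>G\<^esub> e p)" using h(2) by metis
    then show "x [^]\<^bsub>G\<^esub> e p = y [^]\<^bsub>G\<^esub> e p"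
      using bij_betw_imp_inj_on[OF f[OF p]] G.projection_primary p xy by (auto simp: inj_on_def)
  qed
  moreover have "y \<in> h ` carrier G" if y: "y \<in> carrier H" for y
  proof -
    have "\<exists>a\<in>primary_elements G p. f p a = y [^]\<^bsub>H\<^esub> e p" if "p \<in> prime_factors n" for p
      using bij_betw_imp_surj_on[OF f[OF that]] H.projection_primary[OF y that] by (metis imageE)
    then obtain a where a: "\<And>p. p \<in> prime_factors n \<Longrightarrow> a p \<in> primary_elements G p"
        "\<And>p. p \<in> prime_factors n \<Longrightarrow> f p (a p) = y [^]\<^bsub>H\<^esub> e p" by metis
    obtain x where x: "x \<in> carrier G" "\<And>p. p \<in> prime_factors n \<Longrightarrow> x [^]\<^bsub>G\<^esub> e p = a p"
      using G.projections_surj[OF a(1)] by blast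
    have "y = h x"
    proof (rule H.projections_eq_imp_eq[OF y h(1)[OF x(1)]])
      show "y [^]\<^bsub>H\<^esub> e p = h x [^]\<^bsub>H\<^esub> e p" if "p \<in> prime_factors n" for p
        using h(2)[OF x(1) that] x(2)[OF that] a(2)[OF that] by simp
    qed
    then show ?thesis using x(1) by blast
  qed
  ultimately have "bij_betw h (carrier G) (carrier H)"
    using h(1) by (auto simp: bij_betw_def)
  moreover have "jointly_cyclic G x y \<longleftrightarrow> jointly_cyclic H (h x) (h y)"
    if xy: "x \<in> carrier G" "y \<in> carrier G" for x y
    unfolding G.jointly_cyclic_iff_projections[OF xy]
      H.jointly_cyclic_iff_projections[OF h(1)[OF xy(1)] h(1)[OF xy(2)]]
    using h(2) xy jc G.projection_primary by simp
  ultimately show ?thesis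
    unfolding epg_iso_iff[OF G.is_group G.finite_carrier H.is_group H.finite_carrier] by blast
qed

text \<open>An order-preserving isomorphism maps primary elements onto primary elements. It also
  transports commuting of coprime orders, since commuting then amounts to joint cyclicity.\<close>

lemma epg_iso_imp_primary:
  assumes G: "group G" "finite (carrier G)" and H: "group H" "finite (carrier H)"
    and cc: "coprime_orders_commute G" and iso: "epg_iso G H"
  shows "coprime_orders_commute H \<and>
    (\<forall>p. \<exists>h. bij_betw h (primary_elements G p) (primary_elements H p) \<and>
      (\<forall>x\<in>primary_elements G p. \<forall>y\<in>primary_elements G p.
        jointly_cyclic G x y \<longleftrightarrow> jointly_cyclic H (h x) (h y)))"
proof -
  interpret G: group G by fact
  interpret H: group H by fact
  obtain f where "bij_betw f (carrier G) (carrier H)"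
      "\<And>x y. x \<in> carrier G \<Longrightarrow> y \<in> carrier G \<Longrightarrow>
        jointly_cyclic G x y \<longleftrightarrow> jointly_cyclic H (f x) (f y)"
    using iso epg_iso_iff[OF G H] by blast
  from jointly_cyclic_iso_preserving_ord[OF G H this]
  obtain h where h: "bij_betw h (carrier G) (carrier H)"
    "\<And>x y. x \<in> carrier G \<Longrightarrow> y \<in> carrier G \<Longrightarrow>
      jointly_cyclic G x y \<longleftrightarrow> jointly_cyclic H (h x) (h y)"
    "\<And>x. x \<in> carrier G \<Longrightarrow> H.ord (h x) = G.ord x" by metis
  have img: "h ` carrier G = carrier H" using h(1) by (simp add: bij_betw_def)
  have "coprime_orders_commute H"
    unfolding coprime_orders_commute_def
  proof (intro ballI impI)
    fix u v assume uv: "u \<in> carrier H" "v \<in> carrier H" "coprime (H.ord u) (H.ord v)"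
    obtain x y where xy: "x \<in> carrier G" "y \<in> carrier G" "u = h x" "v = h y"
      using uv img by blast
    have cop: "coprime (G.ord x) (G.ord y)" using uv(3) xy h(3) by simp
    then have "x \<otimes>\<^bsub>G\<^esub> y = y \<otimes>\<^bsub>G\<^esub> x" using cc xy by (auto simp: coprime_orders_commute_def)
    from G.commute_coprime_imp_jointly_cyclic[OF G(2) xy(1,2) cop this]
    show "u \<otimes>\<^bsub>H\<^esub> v = v \<otimes>\<^bsub>H\<^esub> u"
      using h(2) xy H.jointly_cyclic_imp_commute[OF H(2)] by blast
  qed
  moreover have "bij_betw h (primary_elements G p) (primary_elements H p)" for p
  proof (rule bij_betw_subset[OF h(1)])
    show "primary_elements G p \<subseteq> carrier G" by (auto simp: primary_elements_def)
    show "h ` primary_elements G p = primary_elements H p"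
    proof (intro equalityI subsetI)
      show "v \<in> primary_elements H p" if "v \<in> h ` primary_elements G p" for v
        using that h(3) img by (auto simp: primary_elements_def)
    next
      fix v assume v: "v \<in> primary_elements H p"
      then obtain x where x: "x \<in> carrier G" "v = h x"
        using img by (auto simp: primary_elements_def)
      then show "v \<in> h ` primary_elements G p"
        using v h(3)[OF x(1)] by (auto simp: primary_elements_def)
    qed
  qed
  ultimately show ?thesis using h(2) by (auto simp: primary_elements_def)
qed

lemma primary_isos_imp_epg_iso:
  assumes G: "group G" "finite (carrier G)" "coprime_orders_commute G"
    and H: "group H" "finite (carrier H)" "coprime_orders_commute H"
    and iso: "\<And>p. Factorial_Ring.prime p \<Longrightarrow>
      \<exists>h. bij_betw h (primary_elements G p) (primary_elements H p) \<and>
        (\<forall>x\<in>primary_elements G p. \<forall>y\<in>primary_elements G p.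
          jointly_cyclic G x y \<longleftrightarrow> jointly_cyclic H (h x) (h y))"
  shows "epg_iso G H"
proof -
  interpret G: group G by fact
  interpret H: group H by fact
  \<comment> \<open>The product is an exponent for both groups, and one choice of \<open>e\<close>
    then serves both decompositions.\<close>
  define n where "n = order G * order H"
  have n: "n > 0" using G(2) H(2) G.order_gt_0_iff_finite H.order_gt_0_iff_finite by (simp add: n_def)
  obtain e where e: "idempotent_exponents n e" using idempotent_exponents_exist by blast
  have "x [^]\<^bsub>G\<^esub> n = \<one>\<^bsub>G\<^esub>" if "x \<in> carrier G" for x
    using that G.ord_dvd_group_order[OF that] by (simp add: n_def G.pow_eq_id)
  then have PG: "primary_decomposition G n e" using G n e by unfold_locales auto
  have "x [^]\<^bsub>H\<^esub> n = \<one>\<^bsub>H\<^esub>" if "x \<in> carrier H" for x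
    using that H.ord_dvd_group_order[OF that] by (simp add: n_def H.pow_eq_id)
  then have PH: "primary_decomposition H n e" using H n e by unfold_locales auto
  obtain f where f: "\<And>p. p \<in> prime_factors n \<Longrightarrow>
      bij_betw (f p) (primary_elements G p) (primary_elements H p)"
    "\<And>p x y. p \<in> prime_factors n \<Longrightarrow> x \<in> primary_elements G p \<Longrightarrow>
      y \<in> primary_elements G p \<Longrightarrow> jointly_cyclic G x y \<longleftrightarrow> jointly_cyclic H (f p x) (f p y)"
    using iso in_prime_factors_imp_prime by metis
  show ?thesis using f by (intro glue_primary_isos[OF PG PH, of f]) blast+
qed

theorem theorem1:
  fixes G :: "('a, 'b) monoid_scheme" and H :: "('c, 'd) monoid_scheme"
  assumes "group G" "finite (carrier G)" "nilpotent G"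
    and "group H" "finite (carrier H)"
  shows "epg_iso G H \<longleftrightarrow>
           (nilpotent H \<and>
            (\<forall>p::nat. Factorial_Ring.prime p \<longrightarrow>
               (\<forall>P Q. sylow_subgroup G p P \<longrightarrow> sylow_subgroup H p Q \<longrightarrow>
                  epg_iso (G\<lparr>carrier := P\<rparr>) (H\<lparr>carrier := Q\<rparr>))))"
proof -
  interpret G: group G by fact
  interpret H: group H by fact
  note fin = \<open>finite (carrier G)\<close> \<open>finite (carrier H)\<close>
  have ccG: "coprime_orders_commute G"
    using \<open>nilpotent G\<close> by (rule G.nilpotent_imp_coprime_orders_commute)
  have nilH: "nilpotent H \<longleftrightarrow> coprime_orders_commute H"
    using H.nilpotent_imp_coprime_orders_commute H.coprime_orders_commute_imp_nilpotent[OF fin(2)]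
    by blast
  \<comment> \<open>Each group has exactly one Sylow \<open>p\<close>-subgroup, its set of primary
    elements, so the quantifiers over \<open>P\<close> and \<open>Q\<close> collapse to a single
    pair.\<close>
  have sylow: "(\<forall>P Q. sylow_subgroup G p P \<longrightarrow> sylow_subgroup H p Q \<longrightarrow>
        epg_iso (G\<lparr>carrier := P\<rparr>) (H\<lparr>carrier := Q\<rparr>)) \<longleftrightarrow>
      (\<exists>h. bij_betw h (primary_elements G p) (primary_elements H p) \<and>
        (\<forall>x\<in>primary_elements G p. \<forall>y\<in>primary_elements G p.
          jointly_cyclic G x y \<longleftrightarrow> jointly_cyclic H (h x) (h y)))"
    if ccH: "coprime_orders_commute H" and p: "Factorial_Ring.prime p" for p
  proof -
    note S = G.sylow_subgroup_iff[OF fin(1) ccG p] H.sylow_subgroup_iff[OF fin(2) ccH p]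
    have "subgroup (primary_elements G p) G" "subgroup (primary_elements H p) H"
      using S by (auto simp: sylow_subgroup_def)
    then show ?thesis
      using epg_iso_subgroup_iff[OF assms(1,2) _ assms(4,5)] S by simp
  qed
  show ?thesis
  proof
    assume "epg_iso G H"
    from epg_iso_imp_primary[OF assms(1,2,4,5) ccG this]
    show "nilpotent H \<and> (\<forall>p::nat. Factorial_Ring.prime p \<longrightarrow>
        (\<forall>P Q. sylow_subgroup G p P \<longrightarrow> sylow_subgroup H p Q \<longrightarrow>
          epg_iso (G\<lparr>carrier := P\<rparr>) (H\<lparr>carrier := Q\<rparr>)))"
      using sylow nilH by blast
  next
    assume "nilpotent H \<and> (\<forall>p::nat. Factorial_Ring.prime p \<longrightarrow>
        (\<forall>P Q. sylow_subgroup G p P \<longrightarrow> sylow_subgroup H p Q \<longrightarrow>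
          epg_iso (G\<lparr>carrier := P\<rparr>) (H\<lparr>carrier := Q\<rparr>)))"
    then show "epg_iso G H"
      using sylow nilH by (intro primary_isos_imp_epg_iso[OF assms(1,2) ccG assms(4,5)]) blast+
  qed
qed

end
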